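(* Let $(\mathbb H,d)$ be the sub-Riemannian Heisenberg group with sub-Riemannian structure $(\Delta,\rho)$. For $v\in\mathfrak h$, define the norm $$\lVert v\rVert=\sqrt{\rho(v_h,v_h)}+\lvert\lambda\rvert,$$ where $v=v_h+\lambda Z$ with $v_h\in\mathrm{span}\{X,Y\}$ and $\lambda\in\mathbb R$. Denote by $d_F$ the Finsler distance function associated with this norm, and by $B_F(r)$ the ball of radius $r$ with respect to $d_F$ centered at the identity element of $\mathbb H$. Fix a Haar measure $\mathrm{vol}$ on $\mathbb H$. Then there exists $r_0>0$ such that $$d(p,q)=d_F(p,q)\quad\text{for every }p,q\in\mathbb H\text{ such that }d(p,q)\ge r_0.$$ In particular, there exists $C>0$ such that $\mathrm{vol}(B_F(r))=Cr^4$ for every $r\ge r_0$.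
   Context: The Heisenberg Lie algebra $\mathfrak h$ has basis $\{X,Y,Z\}$ with only non-trivial bracket $[X,Y]=Z$; the Heisenberg group is $\mathbb H=(\mathfrak h,* )$ with $x*y=x+y+\frac12[x,y]$. The sub-Riemannian Heisenberg group $(\mathbb H,d)$ has sub-Riemannian structure $(\Delta,\rho)$, where $\Delta$ is the left-invariant subbundle with $\Delta_e=\mathrm{span}\{X,Y\}$ and $\rho$ is the left-invariant metric tensor on $\Delta$ with $\{X,Y\}$ orthonormal; $d(p,q)$ is the infimum of $\int_0^1\sqrt{\rho(\dot\gamma,\dot\gamma)}\,dt$ over absolutely continuous curves $\gamma:[0,1]\to\mathbb H$ from $p$ to $q$ that are tangent to $\Delta$ a.e. The Finsler distance associated with a norm $\lVert\cdot\rVert$ on $\mathfrak h$ is $d_F(p,q)=\inf\int_0^1\lVert (dL_{\gamma(t)})^{-1}\dot\gamma(t)\rVert\,dt$ over absolutely continuous curves $\gamma:[0,1]\to\mathbb H$ from $p$ to $q$. *)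

theory Defs
  imports "HOL-Analysis.Analysis"
begin

section \<open>The Heisenberg Lie algebra and group\<close>

text \<open>The Lie algebra is \<open>real^3\<close> with \<open>X, Y, Z\<close> the standard basis.  The group has the same
  carrier, with unit \<open>0\<close>, and all its tangent spaces are identified with \<open>real^3\<close> through the
  global chart \<open>id\<close>; the Lie algebra is the tangent space at \<open>0\<close>.\<close>

type_synonym heis = "real^3"

definition hX :: heis where "hX = axis 1 1"
definition hY :: heis where "hY = axis 2 1"
definition hZ :: heis where "hZ = axis 3 1"

definition hbracket :: "heis \<Rightarrow> heis \<Rightarrow> heis" where
  "hbracket u v = (u $ 1 * v $ 2 - u $ 2 * v $ 1) *\<^sub>R hZ"

definition hmult :: "heis \<Rightarrow> heis \<Rightarrow> heis" (infixl \<open>\<star>\<close> 70) where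
  "p \<star> q = p + q + (1/2) *\<^sub>R hbracket p q"

text \<open>Differential at the unit of the left translation by \<open>p\<close>, a map from the Lie algebra to the
  tangent space at \<open>p\<close>.\<close>
definition dL :: "heis \<Rightarrow> heis \<Rightarrow> heis" where
  "dL p = frechet_derivative (\<lambda>x. p \<star> x) (at 0)"


section \<open>The sub-Riemannian structure\<close>

definition Delta :: "heis \<Rightarrow> heis set" where
  "Delta p = dL p ` span {hX, hY}"

text \<open>The inner product on \<open>span {hX, hY}\<close> with \<open>hX, hY\<close> orthonormal.  As HOL functions are total,
  it and \<open>rho p\<close> also have values off \<open>Delta 0\<close> and \<open>Delta p\<close>; these are only ever used on a null
  set of times.\<close>
definition rho_e :: "heis \<Rightarrow> heis \<Rightarrow> real" where
  "rho_e u v = u $ 1 * v $ 1 + u $ 2 * v $ 2"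

definition rho :: "heis \<Rightarrow> heis \<Rightarrow> heis \<Rightarrow> real" where
  "rho p u v = rho_e (inv (dL p) u) (inv (dL p) v)"


section \<open>Curves and distances\<close>

text \<open>Absolute continuity of a curve on \<open>{a..b}\<close>; \<open>D\<close> is a finite family of non-overlapping
  subintervals, each given by its pair of endpoints.  (The library constant
  \<open>absolutely_continuous\<close> is about measures.)\<close>
definition abs_continuous_on :: "real \<Rightarrow> real \<Rightarrow> (real \<Rightarrow> 'a::real_normed_vector) \<Rightarrow> bool" where
  "abs_continuous_on a b \<gamma> \<longleftrightarrow>
    (\<forall>\<epsilon>>0. \<exists>\<delta>>0. \<forall>D :: (real \<times> real) set.
       finite D \<and> (\<forall>(s, t)\<in>D. a \<le> s \<and> s < t \<and> t \<le> b) \<and>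
       pairwise (\<lambda>I J. disjnt {fst I<..<snd I} {fst J<..<snd J}) D \<and>
       (\<Sum>(s, t)\<in>D. t - s) < \<delta>
       \<longrightarrow> (\<Sum>(s, t)\<in>D. norm (\<gamma> t - \<gamma> s)) < \<epsilon>)"

definition ac_curve :: "heis \<Rightarrow> heis \<Rightarrow> (real \<Rightarrow> heis) \<Rightarrow> bool" where
  "ac_curve p q \<gamma> \<longleftrightarrow> abs_continuous_on 0 1 \<gamma> \<and> \<gamma> 0 = p \<and> \<gamma> 1 = q"

definition velocity :: "(real \<Rightarrow> heis) \<Rightarrow> real \<Rightarrow> heis" where
  "velocity \<gamma> t = vector_derivative \<gamma> (at t within {0..1})"

definition horizontal :: "(real \<Rightarrow> heis) \<Rightarrow> bool" where
  "horizontal \<gamma> \<longleftrightarrow>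
    (AE t in lebesgue_on {0..1}.
       \<gamma> differentiable (at t within {0..1}) \<and> velocity \<gamma> t \<in> Delta (\<gamma> t))"

text \<open>In both distances the infimum is over a set of reals that is nonempty (any two points are
  joined by a horizontal curve) and bounded below by \<open>0\<close>, so \<open>Inf\<close> is the true infimum.  The
  integrands are integrable, since an absolutely continuous curve is differentiable almost
  everywhere with integrable derivative.\<close>

definition sr_dist :: "heis \<Rightarrow> heis \<Rightarrow> real" where
  "sr_dist p q =
    Inf {integral {0..1} (\<lambda>t. sqrt (rho (\<gamma> t) (velocity \<gamma> t) (velocity \<gamma> t))) | \<gamma>.
           ac_curve p q \<gamma> \<and> horizontal \<gamma>}"

definition finsler_dist :: "(heis \<Rightarrow> real) \<Rightarrow> heis \<Rightarrow> heis \<Rightarrow> real" where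
  "finsler_dist N p q =
    Inf {integral {0..1} (\<lambda>t. N (inv (dL (\<gamma> t)) (velocity \<gamma> t))) | \<gamma>. ac_curve p q \<gamma>}"

definition finsler_ball :: "(heis \<Rightarrow> real) \<Rightarrow> real \<Rightarrow> heis set" where
  "finsler_ball N r = {q. finsler_dist N 0 q < r}"

definition horizontal_part :: "heis \<Rightarrow> heis" where
  "horizontal_part v = v $ 1 *\<^sub>R hX + v $ 2 *\<^sub>R hY"

definition heis_norm :: "heis \<Rightarrow> real" where
  "heis_norm v = sqrt (rho 0 (horizontal_part v) (horizontal_part v)) + \<bar>v $ 3\<bar>"


section \<open>Haar measures\<close>

text \<open>Nonzero left-invariant Radon measures on the Borel sets.\<close>
definition haar_measure :: "heis measure \<Rightarrow> bool" where
  "haar_measure \<mu> \<longleftrightarrow>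
    sets \<mu> = sets borel \<and>
    emeasure \<mu> UNIV \<noteq> 0 \<and>
    (\<forall>p. \<forall>A\<in>sets borel. emeasure \<mu> ((\<lambda>x. p \<star> x) ` A) = emeasure \<mu> A) \<and>
    (\<forall>K. compact K \<longrightarrow> emeasure \<mu> K < \<infinity>) \<and>
    (\<forall>A\<in>sets borel. emeasure \<mu> A = (INF U\<in>{U. open U \<and> A \<subseteq> U}. emeasure \<mu> U)) \<and>
    (\<forall>U. open U \<longrightarrow> emeasure \<mu> U = (SUP K\<in>{K. compact K \<and> K \<subseteq> U}. emeasure \<mu> K))"


section \<open>Consistency checks\<close>

lemma hbracket_basis:
  "hbracket hX hY = hZ" "hbracket hX hZ = 0" "hbracket hY hZ = 0"
  by (simp_all add: hbracket_def hX_def hY_def hZ_def axis_def)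

lemma hbracket_skew: "hbracket v u = - hbracket u v"
  by (simp add: vec_eq_iff forall_3 hbracket_def hZ_def axis_def)

lemma bounded_linear_hbracket: "bounded_linear (hbracket p)"
  unfolding linear_conv_bounded_linear[symmetric]
  by (rule linearI) (simp_all add: vec_eq_iff forall_3 hbracket_def hZ_def axis_def field_simps)

lemma heis_decomposition: "v = horizontal_part v + v $ 3 *\<^sub>R hZ"
  by (simp add: vec_eq_iff forall_3 horizontal_part_def hX_def hY_def hZ_def axis_def)

lemma hmult_assoc: "(p \<star> q) \<star> r = p \<star> (q \<star> r)"
  by (simp add: vec_eq_iff forall_3 hmult_def hbracket_def hZ_def axis_def field_simps)

lemma hmult_unit: "0 \<star> p = p" "p \<star> 0 = p"
  by (simp_all add: hmult_def hbracket_def)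

lemma hmult_inverse: "p \<star> (- p) = 0" "(- p) \<star> p = 0"
  by (simp_all add: hmult_def hbracket_def)

lemma dL_eq: "dL p v = v + (1/2) *\<^sub>R hbracket p v"
proof -
  have "((\<lambda>x. (1/2) *\<^sub>R hbracket p x) has_derivative (\<lambda>v. (1/2) *\<^sub>R hbracket p v)) (at 0)"
    by (intro has_derivative_scaleR_right bounded_linear_imp_has_derivative bounded_linear_hbracket)
  moreover have "((\<lambda>x. p + x) has_derivative (\<lambda>v. v)) (at 0)"
    by (auto intro!: derivative_eq_intros)
  ultimately have "((\<lambda>x. p \<star> x) has_derivative (\<lambda>v. v + (1/2) *\<^sub>R hbracket p v)) (at 0)"
    unfolding hmult_def by (rule has_derivative_add[rotated])
  from frechet_derivative_at[OF this] show ?thesis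
    by (simp add: dL_def fun_eq_iff)
qed

lemma hbracket_hbracket: "hbracket p (hbracket q r) = 0"
  by (simp add: hbracket_def hZ_def axis_def)

lemma inv_dL_eq: "inv (dL p) v = v - (1/2) *\<^sub>R hbracket p v"
proof -
  interpret bounded_linear "hbracket p"
    by (rule bounded_linear_hbracket)
  have 1: "dL p (v - (1/2) *\<^sub>R hbracket p v) = v" for v
    by (simp add: dL_eq diff scaleR hbracket_hbracket)
  have 2: "dL p v - (1/2) *\<^sub>R hbracket p (dL p v) = v" for v
    by (simp add: dL_eq add scaleR hbracket_hbracket)
  have "inj (dL p)"
    by (rule inj_on_inverseI[where g = "\<lambda>v. v - (1/2) *\<^sub>R hbracket p v"]) (rule 2)
  then show ?thesis
    by (rule inv_f_eq) (rule 1)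
qed

end

theory Submission
  imports Defs
begin

text \<open>The inequality \<open>d\<^sub>F \<le> d\<close> holds because a horizontal curve has the same length for both structures.
  For the converse, let \<open>\<gamma>\<close> be any curve from \<open>p\<close> to \<open>q\<close>.  Its projection \<open>c\<close> to the plane has some
  length \<open>l\<close>, its velocity has a vertical component (in the left-invariant frame) with some integral
  \<open>A\<close>, and the Finsler length of \<open>\<gamma>\<close> is at least \<open>l + \<bar>A\<bar>\<close>.  As the centre of the group is vertical, the
  horizontal lift of \<open>c\<close> ends at \<open>q\<close> up to the vertical factor \<open>A\<close>.  So it is enough to repair the
  height of the lift at an extra cost of at most \<open>\<bar>A\<bar>\<close>.

  If two points of \<open>c\<close>, at times \<open>s < t\<close>, differ by a vector \<open>z\<close> with \<open>\<bar>z\<bar> \<ge> 2\<close>, then translate the part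
  of \<open>c\<close> between them by a vector \<open>w\<close> orthogonal to \<open>z\<close>.  This inserts two segments of total length
  \<open>2 \<bar>w\<bar>\<close> and changes the height of the end point by \<open>\<plusminus> \<bar>w\<bar> \<bar>z\<bar>\<close>.  With \<open>\<bar>w\<bar> = \<bar>A\<bar> / \<bar>z\<bar>\<close> the height is
  repaired at the cost \<open>2 \<bar>A\<bar> / \<bar>z\<bar> \<le> \<bar>A\<bar>\<close>.  Otherwise \<open>c\<close> stays at distance at most \<open>2\<close> from its starting
  point, so that it sweeps an area of at most \<open>l\<close>.  Then the height \<open>h\<close> of \<open>- p \<star> q\<close> satisfies
  \<open>\<bar>h\<bar> \<le> l + \<bar>A\<bar>\<close>, whereas \<open>d(p, q) \<le> 2 + 4 sqrt \<bar>h\<bar>\<close>.  If \<open>d(p, q) \<ge> 20\<close>, then \<open>sqrt \<bar>h\<bar> \<ge> 9 / 2\<close>, hence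
  \<open>2 + 4 sqrt \<bar>h\<bar> \<le> \<bar>h\<bar>\<close> and again \<open>d(p, q) \<le> l + \<bar>A\<bar>\<close>.  This is \<open>cc_norm_le_length_plus_height\<close>, with
  \<open>r0 = 20\<close>.

  For \<open>r \<ge> 20\<close> the two balls of radius \<open>r\<close> thus coincide, and the sub-Riemannian one is the image of the unit
  ball under the dilation \<open>(x, y, z) \<mapsto> (r x, r y, r\<^sup>2 z)\<close>, which multiplies Lebesgue measure by \<open>r ^ 4\<close>.
  A Haar measure is a multiple of Lebesgue measure (\<open>haar_measure_proportional_lborel\<close>).

  The passage from a curve to its control, the velocity of the planar projection, and back rests on
  Lebesgue's theorems: an absolutely continuous curve is differentiable almost everywhere and is the integral of its
  derivative (\<open>abs_continuous_on_differentiable_ae\<close>, \<open>abs_continuous_on_has_integral_derivative\<close>), and an indefinite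
  integral is absolutely continuous and has the integrand as its derivative almost everywhere
  (\<open>abs_continuous_on_indefinite_integral\<close>, \<open>indefinite_integral_has_derivative_ae\<close>).\<close>

section \<open>Families of non-overlapping intervals\<close>

definition nonoverlapping :: "real \<Rightarrow> real \<Rightarrow> (real \<times> real) set \<Rightarrow> bool" where
  "nonoverlapping a b D \<longleftrightarrow>
     finite D \<and> (\<forall>(s, t)\<in>D. a \<le> s \<and> s < t \<and> t \<le> b) \<and>
     pairwise (\<lambda>I J. disjnt {fst I<..<snd I} {fst J<..<snd J}) D"

lemma disjnt_open_intervals_iff:
  fixes s t u v :: real
  assumes "s < t" "u < v"
  shows "disjnt {s<..<t} {u<..<v} \<longleftrightarrow> t \<le> u \<or> v \<le> s"
proof
  assume dj: "disjnt {s<..<t} {u<..<v}"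
  show "t \<le> u \<or> v \<le> s"
  proof (rule ccontr)
    assume "\<not> (t \<le> u \<or> v \<le> s)"
    then have "max s u < min t v" using assms by auto
    then obtain m where "max s u < m" "m < min t v" using dense by blast
    then have "m \<in> {s<..<t}" "m \<in> {u<..<v}" by auto
    with dj show False by (auto simp: disjnt_def)
  qed
qed (auto simp: disjnt_def)

lemma nonoverlapping_iff:
  "nonoverlapping a b D \<longleftrightarrow>
     finite D \<and> (\<forall>s t. (s, t) \<in> D \<longrightarrow> a \<le> s \<and> s < t \<and> t \<le> b) \<and>
     (\<forall>s t u v. (s, t) \<in> D \<longrightarrow> (u, v) \<in> D \<longrightarrow> (s, t) \<noteq> (u, v) \<longrightarrow> t \<le> u \<or> v \<le> s)"
proof (cases "\<forall>s t. (s, t) \<in> D \<longrightarrow> a \<le> s \<and> s < t \<and> t \<le> b")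
  case True
  then have "disjnt {s<..<t} {u<..<v} \<longleftrightarrow> t \<le> u \<or> v \<le> s" if "(s, t) \<in> D" "(u, v) \<in> D" for s t u v
    using that by (intro disjnt_open_intervals_iff) blast+
  then show ?thesis
    unfolding nonoverlapping_def pairwise_def by fastforce
qed (auto simp: nonoverlapping_def)

text \<open>The gaps of a non-overlapping family are intervals too.  Stating completeness of \<open>D \<union> R\<close> by
  telescoping of every function \<open>h\<close> avoids any ordering of the intervals.  The induction removes the interval with
  the largest right end point: all others then lie to the left of it.\<close>
lemma nonoverlapping_complement:
  assumes "nonoverlapping a b D" "a \<le> b"
  obtains R where "nonoverlapping a b (D \<union> R)" "D \<inter> R = {}"
    "\<And>h :: real \<Rightarrow> real. (\<Sum>(s, t)\<in>D \<union> R. h t - h s) = h b - h a"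
proof -
  have "\<exists>R. nonoverlapping a b (D \<union> R) \<and> D \<inter> R = {} \<and>
    (\<forall>h :: real \<Rightarrow> real. (\<Sum>(s, t)\<in>D \<union> R. h t - h s) = h b - h a)"
    using assms
  proof (induction "card D" arbitrary: D b)
    case 0
    then have D: "D = {}" by (auto simp: nonoverlapping_def)
    show ?case
    proof (cases "a < b")
      case True
      then show ?thesis using D
        by (intro exI[of _ "{(a, b)}"]) (auto simp: nonoverlapping_iff)
    next
      case False
      then show ?thesis using D \<open>a \<le> b\<close>
        by (intro exI[of _ "{}"]) (auto simp: nonoverlapping_iff)
    qed
  next
    case (Suc n)
    have fin: "finite D" and D: "\<And>s t. (s, t) \<in> D \<Longrightarrow> a \<le> s \<and> s < t \<and> t \<le> b"
      and sep: "\<And>s t u v. \<lbrakk>(s, t) \<in> D; (u, v) \<in> D; (s, t) \<noteq> (u, v)\<rbrakk> \<Longrightarrow> t \<le> u \<or> v \<le> s"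
      using Suc.prems(1) by (auto simp: nonoverlapping_iff)
    have "D \<noteq> {}" using Suc.hyps(2) by auto
    then have "Max (snd ` D) \<in> snd ` D" using fin by simp
    then obtain u v where uv: "(u, v) \<in> D" and "v = Max (snd ` D)" by force
    then have vmax: "t \<le> v" if "(s, t) \<in> D" for s t
      using that fin by (metis Max_ge finite_imageI image_eqI snd_conv)
    define D' where "D' = D - {(u, v)}"
    have D'u: "t \<le> u" if "(s, t) \<in> D'" for s t
    proof -
      have "t \<le> u \<or> v \<le> s" using sep[of s t u v] that uv by (auto simp: D'_def)
      moreover have "s < t" "t \<le> v" using D vmax that by (auto simp: D'_def)
      ultimately show ?thesis by auto
    qed
    have "nonoverlapping a u D'"
      unfolding nonoverlapping_iff
      using fin D sep D'u by (auto simp: D'_def)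
    moreover have "n = card D'" using Suc.hyps(2) fin uv by (simp add: D'_def)
    moreover have "a \<le> u" using D uv by auto
    ultimately obtain R where R: "nonoverlapping a u (D' \<union> R)" "D' \<inter> R = {}"
      and sumR: "\<And>h :: real \<Rightarrow> real. (\<Sum>(s, t)\<in>D' \<union> R. h t - h s) = h u - h a"
      using Suc.hyps(1)[of D' u] by blast
    define T where "T = (if v < b then {(v, b)} else {})"
    have uvb: "u < v" "v \<le> b" using D uv by auto
    have Ru: "a \<le> s \<and> s < t \<and> t \<le> u" if "(s, t) \<in> D' \<union> R" for s t
      using R(1) that unfolding nonoverlapping_iff by blast
    have finR: "finite (D' \<union> R)" using R(1) by (simp add: nonoverlapping_def)
    have eq: "D \<union> (R \<union> T) = (D' \<union> R) \<union> ({(u, v)} \<union> T)" using uv by (auto simp: D'_def)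
    have dj: "(D' \<union> R) \<inter> ({(u, v)} \<union> T) = {}"
      using Ru uvb by (fastforce simp: T_def split: if_splits)
    have djD: "D \<inter> (R \<union> T) = {}"
      using R(2) dj vmax uv eq by (auto simp: D'_def T_def split: if_splits)
    have "nonoverlapping a b (D \<union> (R \<union> T))"
      unfolding eq
    proof (subst nonoverlapping_iff, intro conjI allI impI)
      show "finite (D' \<union> R \<union> ({(u, v)} \<union> T))" using finR by (auto simp: T_def)
      fix s t assume st: "(s, t) \<in> D' \<union> R \<union> ({(u, v)} \<union> T)"
      then show "a \<le> s" "s < t" "t \<le> b"
        using Ru[of s t] uvb \<open>a \<le> u\<close> by (auto simp: T_def split: if_splits)
      fix s' t' assume st': "(s', t') \<in> D' \<union> R \<union> ({(u, v)} \<union> T)" and ne: "(s, t) \<noteq> (s', t')"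
      have "t \<le> s' \<or> t' \<le> s" if "(s, t) \<in> D' \<union> R" "(s', t') \<in> D' \<union> R"
        using R(1) that ne unfolding nonoverlapping_iff by blast
      then show "t \<le> s' \<or> t' \<le> s"
        using st st' ne Ru[of s t] Ru[of s' t'] uvb by (auto simp: T_def split: if_splits)
    qed
    moreover have "(\<Sum>(s, t)\<in>D \<union> (R \<union> T). h t - h s) = h b - h a" for h :: "real \<Rightarrow> real"
    proof -
      have "(\<Sum>(s, t)\<in>D \<union> (R \<union> T). h t - h s) =
          (\<Sum>(s, t)\<in>D' \<union> R. h t - h s) + (\<Sum>(s, t)\<in>{(u, v)} \<union> T. h t - h s)"
        unfolding eq using finR dj by (intro sum.union_disjoint) (auto simp: T_def)
      also have "(\<Sum>(s, t)\<in>{(u, v)} \<union> T. h t - h s) = h b - h u"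
        using uvb by (auto simp: T_def)
      finally show ?thesis using sumR[of h] by simp
    qed
    ultimately show ?case using djD by blast
  qed
  then show ?thesis using that by blast
qed

lemma sum_increments_le:
  fixes h :: "real \<Rightarrow> real"
  assumes D: "nonoverlapping a b D" and "a \<le> b" and mono: "mono_on {a..b} h"
  shows "(\<Sum>(s, t)\<in>D. h t - h s) \<le> h b - h a"
proof -
  obtain R where R: "nonoverlapping a b (D \<union> R)"
    and sum: "\<And>h :: real \<Rightarrow> real. (\<Sum>(s, t)\<in>D \<union> R. h t - h s) = h b - h a"
    using nonoverlapping_complement[OF D \<open>a \<le> b\<close>] by metis
  have "(\<Sum>(s, t)\<in>D. h t - h s) \<le> (\<Sum>(s, t)\<in>D \<union> R. h t - h s)"
  proof (rule sum_mono2)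
    show "finite (D \<union> R)" using R by (simp add: nonoverlapping_def)
    fix I assume "I \<in> D \<union> R - D"
    then obtain s t where "I = (s, t)" "a \<le> s" "s < t" "t \<le> b"
      using R unfolding nonoverlapping_iff by (cases I) auto
    then show "0 \<le> (case I of (s, t) \<Rightarrow> h t - h s)"
      using monotone_onD[OF mono, of s t] by auto
  qed auto
  then show ?thesis using sum[of h] by simp
qed

text \<open>Telescoping for the step function that jumps at \<open>x\<close> forces some interval to contain \<open>x\<close>.\<close>
lemma nonoverlapping_cover:
  assumes sum: "\<And>h :: real \<Rightarrow> real. (\<Sum>(s, t)\<in>D. h t - h s) = h b - h a"
    and pos: "\<And>s t. (s, t) \<in> D \<Longrightarrow> s < t" and x: "a < x" "x \<le> b"
  obtains s t where "(s, t) \<in> D" "s < x" "x \<le> t"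
proof -
  let ?h = "\<lambda>y. if x \<le> y then 1 else 0 :: real"
  have "(\<Sum>(s, t)\<in>D. ?h t - ?h s) \<noteq> 0" unfolding sum[of ?h] using x by simp
  then obtain I where I: "I \<in> D" "(case I of (s, t) \<Rightarrow> ?h t - ?h s) \<noteq> 0"
    by (meson sum.neutral)
  obtain s t where st: "I = (s, t)" by fastforce
  have "s < t" using pos I st by auto
  then have "s < x" "x \<le> t" using I(2) st by (auto split: if_splits)
  then show ?thesis using that I st by blast
qed

lemma nonoverlapping_refine:
  assumes D: "nonoverlapping a b D"
    and Q: "\<And>s t. (s, t) \<in> D \<Longrightarrow> nonoverlapping s t (Q (s, t))"
  shows "nonoverlapping a b (\<Union>(Q ` D))"
    and "sum f (\<Union>(Q ` D)) = (\<Sum>I\<in>D. sum f (Q I))"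
proof -
  have D': "finite D" "\<And>s t. (s, t) \<in> D \<Longrightarrow> a \<le> s \<and> s < t \<and> t \<le> b"
      "\<And>s t u v. \<lbrakk>(s, t) \<in> D; (u, v) \<in> D; (s, t) \<noteq> (u, v)\<rbrakk> \<Longrightarrow> t \<le> u \<or> v \<le> s"
    using D by (auto simp: nonoverlapping_iff)
  have Q': "finite (Q (s, t))" "\<And>u v. (u, v) \<in> Q (s, t) \<Longrightarrow> s \<le> u \<and> u < v \<and> v \<le> t"
      "\<And>u v x y. \<lbrakk>(u, v) \<in> Q (s, t); (x, y) \<in> Q (s, t); (u, v) \<noteq> (x, y)\<rbrakk> \<Longrightarrow> v \<le> x \<or> y \<le> u"
    if "(s, t) \<in> D" for s t
    using Q[OF that] by (auto simp: nonoverlapping_iff)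
  show "nonoverlapping a b (\<Union>(Q ` D))"
  proof (subst nonoverlapping_iff, intro conjI allI impI)
    show "finite (\<Union>(Q ` D))" using D'(1) Q'(1) by auto
    fix u v assume "(u, v) \<in> \<Union>(Q ` D)"
    then obtain s t where st: "(s, t) \<in> D" "(u, v) \<in> Q (s, t)" by auto
    then show "a \<le> u" "u < v" "v \<le> b" using D'(2)[of s t] Q'(2)[of s t u v] by auto
    fix x y assume "(x, y) \<in> \<Union>(Q ` D)" and ne: "(u, v) \<noteq> (x, y)"
    then obtain s' t' where st': "(s', t') \<in> D" "(x, y) \<in> Q (s', t')" by auto
    show "v \<le> x \<or> y \<le> u"
    proof (cases "(s, t) = (s', t')")
      case True
      then show ?thesis using Q'(3)[of s t u v x y] st st' ne by auto
    next
      case False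
      then show ?thesis
        using D'(3)[of s t s' t'] st st' Q'(2)[of s t u v] Q'(2)[of s' t' x y] by auto
    qed
  qed
  show "sum f (\<Union>(Q ` D)) = (\<Sum>I\<in>D. sum f (Q I))"
  proof (rule sum.UNION_disjoint)
    show "\<forall>I\<in>D. \<forall>J\<in>D. I \<noteq> J \<longrightarrow> Q I \<inter> Q J = {}"
    proof (intro ballI impI)
      fix I J assume IJ: "I \<in> D" "J \<in> D" "I \<noteq> J"
      obtain s t s' t' where eq: "I = (s, t)" "J = (s', t')" by fastforce
      have False if "(u, v) \<in> Q I" "(u, v) \<in> Q J" for u v
        using D'(3)[of s t s' t'] IJ eq Q'(2)[of s t u v] Q'(2)[of s' t' u v] that by auto
      then show "Q I \<inter> Q J = {}" by auto
    qed
  qed (use D' Q' in auto)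
qed

section \<open>Functions of bounded variation\<close>

text \<open>The form in which the Vitali covering theorem is used: if \<open>E\<close> is covered finely by intervals, and disjoint
  ones among these have bounded total length, then this bounds the outer measure of \<open>E\<close>.\<close>
lemma vitali_interval_measure_bound:
  fixes V :: "(real \<times> real) set"
  assumes pos: "\<And>s t. (s, t) \<in> V \<Longrightarrow> s < t"
    and cover: "\<And>x d. x \<in> E \<Longrightarrow> d > 0 \<Longrightarrow> \<exists>s t. (s, t) \<in> V \<and> s \<le> x \<and> x \<le> t \<and> t - s < d"
    and bound: "\<And>F. F \<subseteq> V \<Longrightarrow> finite F \<Longrightarrow> pairwise (\<lambda>I J. disjnt {fst I..snd I} {fst J..snd J}) F \<Longrightarrow>
                  (\<Sum>(s, t)\<in>F. t - s) \<le> M"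
  obtains T where "T \<in> lmeasurable" "E \<subseteq> T" "measure lebesgue T \<le> M"
proof -
  let ?a = "\<lambda>I :: real \<times> real. (fst I + snd I) / 2" and ?r = "\<lambda>I :: real \<times> real. (snd I - fst I) / 2"
  have cb: "cball (?a I) (?r I) = {fst I..snd I}" for I
    unfolding cball_eq_atLeastAtMost by (simp add: field_simps)
  obtain C where C: "countable C" "C \<subseteq> V"
      "pairwise (\<lambda>I J. disjnt {fst I..snd I} {fst J..snd J}) C"
      "negligible (E - (\<Union>I\<in>C. {fst I..snd I}))"
  proof (rule Vitali_covering_theorem_cballs[of V ?r E ?a])
    show "0 < ?r I" if "I \<in> V" for I using pos[of "fst I" "snd I"] that by simp
    fix x d :: real assume "x \<in> E" "0 < d"
    then obtain s t where st: "(s, t) \<in> V" "s \<le> x" "x \<le> t" "t - s < d" using cover by blast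
    then show "\<exists>I. I \<in> V \<and> x \<in> cball (?a I) (?r I) \<and> ?r I < d"
      unfolding cb by (intro exI[of _ "(s, t)"]) auto
  next
    fix C assume "countable C" "C \<subseteq> V"
      "pairwise (\<lambda>i j. disjnt (cball (?a i) (?r i)) (cball (?a j) (?r j))) C"
      "negligible (E - (\<Union>i\<in>C. cball (?a i) (?r i)))"
    then show thesis using that[of C] unfolding cb by simp
  qed
  let ?U = "\<Union>I\<in>C. {fst I..snd I}"
  have fin: "measure lebesgue (\<Union>I\<in>F. {fst I..snd I}) \<le> M" if F: "F \<subseteq> C" "finite F" for F
  proof -
    have "measure lebesgue (\<Union>I\<in>F. {fst I..snd I}) \<le> (\<Sum>I\<in>F. measure lebesgue {fst I..snd I})"
      using F by (intro measure_UNION_le) auto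
    also have "\<dots> = (\<Sum>(s, t)\<in>F. t - s)"
    proof (intro sum.cong refl)
      fix I assume "I \<in> F"
      then have "fst I < snd I" using pos[of "fst I" "snd I"] F C by auto
      then show "measure lebesgue {fst I..snd I} = (case I of (s, t) \<Rightarrow> t - s)"
        by (simp add: split_beta)
    qed
    also have "\<dots> \<le> M"
      using F C by (intro bound) (auto intro: pairwise_subset)
    finally show ?thesis .
  qed
  have U: "?U \<in> lmeasurable" "measure lebesgue ?U \<le> M"
    using fmeasurable_UN_bound[OF C(1), of "\<lambda>I. {fst I..snd I}" lebesgue M]
      measure_UN_bound[OF C(1), of "\<lambda>I. {fst I..snd I}" lebesgue M] fin lmeasurable_interval by auto
  have N: "E - ?U \<in> lmeasurable" "measure lebesgue (E - ?U) = 0"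
    using negligible_imp_measurable[OF C(4)] negligible_imp_measure0[OF C(4)] by simp_all
  show ?thesis
  proof
    show "?U \<union> (E - ?U) \<in> lmeasurable" using U(1) N(1) by (rule fmeasurable.Un)
    show "measure lebesgue (?U \<union> (E - ?U)) \<le> M"
      using measure_Un_le[of ?U lebesgue "E - ?U"] U N by auto
  qed auto
qed

text \<open>Take a partition \<open>D\<close> on which the variation is within \<open>2 c e\<close> of its supremum \<open>S\<close>.  Near a point of
  the exceptional set there are short intervals over which the increment of \<open>g\<close> is steep and has the sign
  opposite to the increment over the surrounding interval of \<open>D\<close>.  Refining \<open>D\<close> by disjoint intervals of
  this kind raises the variation by at least \<open>2 c\<close> times their total length, which is therefore at most \<open>e\<close>.\<close>
lemma bv_oscillation_negligible:
  fixes g :: "real \<Rightarrow> real"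
  assumes "a \<le> b" and "c > 0"
    and bv: "\<And>D. nonoverlapping a b D \<Longrightarrow> (\<Sum>(s, t)\<in>D. \<bar>g t - g s\<bar>) \<le> B"
  shows "negligible {x\<in>{a<..<b}. \<forall>d>0.
           (\<exists>s t. s \<le> x \<and> x \<le> t \<and> s < t \<and> t - s < d \<and> g t - g s > c * (t - s)) \<and>
           (\<exists>s t. s \<le> x \<and> x \<le> t \<and> s < t \<and> t - s < d \<and> g t - g s < - c * (t - s))}"
    (is "negligible ?E")
proof (unfold negligible_outer_le, intro allI impI)
  fix e :: real assume "e > 0"
  define var where "var D = (\<Sum>(s, t)\<in>D. \<bar>g t - g s\<bar>)" for D
  define S where "S = (SUP D\<in>Collect (nonoverlapping a b). var D)"
  have bdd: "bdd_above (var ` Collect (nonoverlapping a b))"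
    using bv by (intro bdd_aboveI2[of _ _ B]) (auto simp: var_def)
  have S: "var D \<le> S" if "nonoverlapping a b D" for D
    unfolding S_def using that bdd by (intro cSUP_upper) auto
  have ne: "Collect (nonoverlapping a b) \<noteq> {}"
    by (metis mem_Collect_eq empty_iff nonoverlapping_iff finite.emptyI)
  have "S - 2 * c * e < S" using \<open>c > 0\<close> \<open>e > 0\<close> by simp
  then obtain D0 where D0: "nonoverlapping a b D0" "S - 2 * c * e < var D0"
    unfolding S_def using less_cSUP_iff[OF ne bdd] by auto
  obtain R0 where D: "nonoverlapping a b (D0 \<union> R0)"
    and sumD: "\<And>h :: real \<Rightarrow> real. (\<Sum>(s, t)\<in>D0 \<union> R0. h t - h s) = h b - h a"
    using nonoverlapping_complement[OF D0(1) \<open>a \<le> b\<close>] by metis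
  define D where "D = D0 \<union> R0"
  note D = D[folded D_def] and sumD = sumD[folded D_def]
  have D': "finite D" "\<And>s t. (s, t) \<in> D \<Longrightarrow> a \<le> s \<and> s < t \<and> t \<le> b"
    using D by (auto simp: nonoverlapping_iff)
  have "var D0 \<le> var D"
    unfolding var_def using D'(1) by (intro sum_mono2) (auto simp: D_def)
  then have varD: "S - 2 * c * e < var D" using D0 by simp
  define \<sigma> :: "real \<times> real \<Rightarrow> real" where "\<sigma> = (\<lambda>(s, t). if g s \<le> g t then 1 else - 1)"
  have \<sigma>: "\<sigma> (s, t) * (g t - g s) = \<bar>g t - g s\<bar>" "\<sigma> I * x \<le> \<bar>x\<bar>" for s t I x
    by (auto simp: \<sigma>_def split: prod.splits)
  define V where "V = {(u, v). \<exists>s t. (s, t) \<in> D \<and> s \<le> u \<and> u < v \<and> v \<le> t \<and>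
                         \<sigma> (s, t) * (g v - g u) < - c * (v - u)}"
  let ?P = "fst ` D \<union> snd ` D"
  obtain T where T: "T \<in> lmeasurable" "?E - ?P \<subseteq> T" "measure lebesgue T \<le> e"
  proof (rule vitali_interval_measure_bound[of V "?E - ?P" e])
    show "s < t" if "(s, t) \<in> V" for s t using that by (auto simp: V_def)
  next
    fix x d :: real assume x: "x \<in> ?E - ?P" and "d > 0"
    then have "a < x" "x \<le> b" by auto
    have xpos: "\<exists>s t. s \<le> x \<and> x \<le> t \<and> s < t \<and> t - s < d \<and> g t - g s > c * (t - s)"
      and xneg: "\<exists>s t. s \<le> x \<and> x \<le> t \<and> s < t \<and> t - s < d \<and> g t - g s < - c * (t - s)"
      if "d > 0" for d
      using x that by auto
    then obtain s t where st: "(s, t) \<in> D" "s < x" "x \<le> t"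
      using nonoverlapping_cover[OF sumD D'(2)[THEN conjunct2, THEN conjunct1] \<open>a < x\<close> \<open>x \<le> b\<close>] by blast
    have "x \<notin> snd ` D" using x by blast
    then have "x \<noteq> t" using st(1) by force
    then have "x < t" using st(3) by simp
    define d' where "d' = min d (min (x - s) (t - x))"
    have "d' > 0" using \<open>d > 0\<close> \<open>x < t\<close> st by (simp add: d'_def)
    then obtain u v where uv: "u \<le> x" "x \<le> v" "u < v" "v - u < d'"
        "\<sigma> (s, t) * (g v - g u) < - c * (v - u)"
    proof (cases "g s \<le> g t")
      case True
      obtain u v where "u \<le> x" "x \<le> v" "u < v" "v - u < d'" "g v - g u < - c * (v - u)"
        using xneg[OF \<open>d' > 0\<close>] by blast
      then show ?thesis using that True by (auto simp: \<sigma>_def)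
    next
      case False
      obtain u v where "u \<le> x" "x \<le> v" "u < v" "v - u < d'" "g v - g u > c * (v - u)"
        using xpos[OF \<open>d' > 0\<close>] by blast
      then show ?thesis using that False by (auto simp: \<sigma>_def)
    qed
    have "s \<le> u" "v \<le> t" "v - u < d" using uv st by (auto simp: d'_def)
    then have "(u, v) \<in> V" using uv st(1) unfolding V_def by blast
    then show "\<exists>u v. (u, v) \<in> V \<and> u \<le> x \<and> x \<le> v \<and> v - u < d"
      using uv \<open>v - u < d\<close> by blast
  next
    fix F assume F: "F \<subseteq> V" "finite F"
      and dj: "pairwise (\<lambda>I J. disjnt {fst I..snd I} {fst J..snd J}) F"
    have sep: "v < x \<or> y < u" if "(u, v) \<in> F" "(x, y) \<in> F" "(u, v) \<noteq> (x, y)" for u v x y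
    proof -
      have "disjnt {u..v} {x..y}" using dj that unfolding pairwise_def by fastforce
      moreover have "u < v" "x < y" using that F by (auto simp: V_def)
      ultimately show ?thesis
        by (auto simp: disjnt_def Int_atLeastAtMost)
    qed
    define G where "G I = {(u, v)\<in>F. fst I \<le> u \<and> v \<le> snd I}" for I
    have G: "nonoverlapping s t (G (s, t))" for s t
    proof (subst nonoverlapping_iff, intro conjI allI impI)
      show "finite (G (s, t))" using F(2) by (rule finite_subset[rotated]) (auto simp: G_def)
      fix u v assume uv: "(u, v) \<in> G (s, t)"
      then show "s \<le> u" "u < v" "v \<le> t" using F(1) by (auto simp: G_def V_def)
      fix x y assume "(x, y) \<in> G (s, t)" "(u, v) \<noteq> (x, y)"
      then show "v \<le> x \<or> y \<le> u" using sep[of u v x y] uv by (auto simp: G_def)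
    qed
    have "\<exists>R. nonoverlapping (fst I) (snd I) (G I \<union> R) \<and> G I \<inter> R = {} \<and>
        (\<forall>h :: real \<Rightarrow> real. (\<Sum>(s, t)\<in>G I \<union> R. h t - h s) = h (snd I) - h (fst I))"
      if "I \<in> D" for I
    proof -
      have "fst I \<le> snd I" using D'(2)[of "fst I" "snd I"] that by simp
      with G[of "fst I" "snd I"] obtain R where "nonoverlapping (fst I) (snd I) (G I \<union> R)"
        "G I \<inter> R = {}" "\<And>h :: real \<Rightarrow> real. (\<Sum>(s, t)\<in>G I \<union> R. h t - h s) = h (snd I) - h (fst I)"
        using nonoverlapping_complement[of "fst I" "snd I" "G I"] unfolding prod.collapse by blast
      then show ?thesis by blast
    qed
    then obtain R where R': "\<And>I. I \<in> D \<Longrightarrow> nonoverlapping (fst I) (snd I) (G I \<union> R I) \<and>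
        G I \<inter> R I = {} \<and>
        (\<forall>h :: real \<Rightarrow> real. (\<Sum>(s, t)\<in>G I \<union> R I. h t - h s) = h (snd I) - h (fst I))"
      by metis
    have R: "\<And>I. I \<in> D \<Longrightarrow> nonoverlapping (fst I) (snd I) (G I \<union> R I)"
        "\<And>I. I \<in> D \<Longrightarrow> G I \<inter> R I = {}"
        "\<And>I h. I \<in> D \<Longrightarrow> (\<Sum>(s, t)\<in>G I \<union> R I. h t - h s :: real) = h (snd I) - h (fst I)"
      using R' by blast+
    \<comment> \<open>Inside \<open>I\<close> the chosen intervals run against the increment of \<open>g\<close> over \<open>I\<close>.\<close>
    have gain: "\<bar>g t - g s\<bar> + 2 * c * (\<Sum>(u, v)\<in>G (s, t). v - u) \<le> var (G (s, t) \<union> R (s, t))"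
      if st: "(s, t) \<in> D" for s t
    proof -
      let ?I = "(s, t)" let ?d = "\<lambda>J. case J of (u, v) \<Rightarrow> g v - g u"
      have fin: "finite (G ?I)" "finite (R ?I)" using R(1)[OF st] by (auto simp: nonoverlapping_def)
      have neg: "\<sigma> ?I * ?d J \<le> - c * (case J of (u, v) \<Rightarrow> v - u)" if J: "J \<in> G ?I" for J
      proof -
        obtain u v where uv: "J = (u, v)" "(u, v) \<in> F" "s \<le> u" "v \<le> t" using J by (auto simp: G_def)
        then obtain s' t' where st': "(s', t') \<in> D" "s' \<le> u" "u < v" "v \<le> t'"
            "\<sigma> (s', t') * (g v - g u) < - c * (v - u)"
          using F by (auto simp: V_def)
        have "(s', t') = (s, t)"
        proof (rule ccontr)
          assume ne: "(s', t') \<noteq> (s, t)"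
          have "t' \<le> s \<or> t \<le> s'"
            using D st st'(1) ne unfolding nonoverlapping_iff by blast
          then show False using st' uv by auto
        qed
        then show ?thesis using st' uv by simp
      qed
      have "\<bar>g t - g s\<bar> = \<sigma> ?I * (\<Sum>J\<in>G ?I \<union> R ?I. ?d J)"
        using R(3)[OF st, of g] \<sigma>(1) by simp
      also have "\<dots> = (\<Sum>J\<in>G ?I. \<sigma> ?I * ?d J) + (\<Sum>J\<in>R ?I. \<sigma> ?I * ?d J)"
        using fin R(2)[OF st] by (simp add: sum.union_disjoint sum_distrib_left distrib_left)
      also have "(\<Sum>J\<in>R ?I. \<sigma> ?I * ?d J) \<le> (\<Sum>J\<in>R ?I. \<bar>?d J\<bar>)"
        by (intro sum_mono \<sigma>)
      also have "(\<Sum>J\<in>G ?I. \<sigma> ?I * ?d J) \<le>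
          (\<Sum>J\<in>G ?I. \<bar>?d J\<bar> - 2 * c * (case J of (u, v) \<Rightarrow> v - u))"
      proof (intro sum_mono)
        fix J assume "J \<in> G ?I"
        from neg[OF this] show "\<sigma> ?I * ?d J \<le> \<bar>?d J\<bar> - 2 * c * (case J of (u, v) \<Rightarrow> v - u)"
          using \<sigma>(2)[of ?I "- ?d J"] by simp
      qed
      also have "\<dots> = (\<Sum>J\<in>G ?I. \<bar>?d J\<bar>) - 2 * c * (\<Sum>(u, v)\<in>G ?I. v - u)"
        by (simp add: sum_subtractf sum_distrib_left)
      also have "(\<Sum>J\<in>G ?I. \<bar>?d J\<bar>) - 2 * c * (\<Sum>(u, v)\<in>G ?I. v - u) + (\<Sum>J\<in>R ?I. \<bar>?d J\<bar>) =
          var (G ?I \<union> R ?I) - 2 * c * (\<Sum>(u, v)\<in>G ?I. v - u)"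
        using fin R(2)[OF st] by (simp add: var_def sum.union_disjoint split_beta)
      finally show ?thesis by simp
    qed
    have Q: "nonoverlapping a b (\<Union>I\<in>D. G I \<union> R I)"
        "var (\<Union>I\<in>D. G I \<union> R I) = (\<Sum>I\<in>D. var (G I \<union> R I))"
    proof -
      have "nonoverlapping s t (G (s, t) \<union> R (s, t))" if "(s, t) \<in> D" for s t
        using R(1)[OF that] by simp
      from nonoverlapping_refine[OF D this]
      show "nonoverlapping a b (\<Union>I\<in>D. G I \<union> R I)"
        "var (\<Union>I\<in>D. G I \<union> R I) = (\<Sum>I\<in>D. var (G I \<union> R I))"
        unfolding var_def by auto
    qed
    have "F = (\<Union>I\<in>D. G I)"
    proof (intro equalityI subsetI)
      fix J assume J: "J \<in> F"
      then obtain u v s t where "J = (u, v)" "(s, t) \<in> D" "s \<le> u" "v \<le> t"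
        using F(1) by (auto simp: V_def)
      then show "J \<in> (\<Union>I\<in>D. G I)" using J by (intro UN_I[of "(s, t)"]) (auto simp: G_def)
    qed (auto simp: G_def)
    then have "(\<Sum>(u, v)\<in>F. v - u) = (\<Sum>I\<in>D. \<Sum>(u, v)\<in>G I. v - u)"
      using nonoverlapping_refine(2)[OF D G] by simp
    then have "var D + 2 * c * (\<Sum>(u, v)\<in>F. v - u) =
        (\<Sum>(s, t)\<in>D. \<bar>g t - g s\<bar> + 2 * c * (\<Sum>(u, v)\<in>G (s, t). v - u))"
      by (simp add: var_def sum.distrib sum_distrib_left split_beta)
    also have "\<dots> \<le> (\<Sum>I\<in>D. var (G I \<union> R I))"
      by (intro sum_mono) (use gain in auto)
    also have "\<dots> \<le> S" using S[OF Q(1)] Q(2) by simp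
    finally have "2 * c * (\<Sum>(u, v)\<in>F. v - u) \<le> 2 * c * e" using varD by simp
    then show "(\<Sum>(u, v)\<in>F. v - u) \<le> e" using \<open>c > 0\<close> by simp
  qed blast
  have P: "negligible ?P" using D'(1) by (intro negligible_finite) auto
  show "\<exists>T. ?E \<subseteq> T \<and> T \<in> lmeasurable \<and> measure lebesgue T \<le> e"
  proof (intro exI conjI)
    show "?E \<subseteq> T \<union> ?P" using T by blast
    show "T \<union> ?P \<in> lmeasurable" using T P negligible_imp_measurable by blast
    show "measure lebesgue (T \<union> ?P) \<le> e"
      using measure_Un_le[of T lebesgue ?P] T P negligible_imp_measurable[OF P] negligible_imp_measure0[OF P]
      by auto
  qed
qed

lemma bv_infinite_slope_negligible:
  fixes g :: "real \<Rightarrow> real"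
  assumes bv: "\<And>D. nonoverlapping a b D \<Longrightarrow> (\<Sum>(s, t)\<in>D. \<bar>g t - g s\<bar>) \<le> B"
  shows "negligible {x\<in>{a<..<b}. \<forall>d>0. \<forall>c. \<exists>s t. s \<le> x \<and> x \<le> t \<and> s < t \<and> t - s < d \<and>
           \<bar>g t - g s\<bar> > c * (t - s)}" (is "negligible ?E")
proof (unfold negligible_outer_le, intro allI impI)
  fix e :: real assume "e > 0"
  have "B \<ge> 0" using bv[of "{}"] by (simp add: nonoverlapping_iff)
  define c where "c = (B + 1) / e"
  have "c > 0" using \<open>e > 0\<close> \<open>B \<ge> 0\<close> by (simp add: c_def)
  define V where "V = {(s, t). a \<le> s \<and> s < t \<and> t \<le> b \<and> \<bar>g t - g s\<bar> > c * (t - s)}"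
  obtain T where "T \<in> lmeasurable" "?E \<subseteq> T" "measure lebesgue T \<le> e"
  proof (rule vitali_interval_measure_bound[of V ?E e])
    show "s < t" if "(s, t) \<in> V" for s t using that by (auto simp: V_def)
  next
    fix x d :: real assume x: "x \<in> ?E" and "d > 0"
    define d' where "d' = min d (min (x - a) (b - x))"
    have "d' > 0" using x \<open>d > 0\<close> by (simp add: d'_def)
    then obtain s t where "s \<le> x" "x \<le> t" "s < t" "t - s < d'" "\<bar>g t - g s\<bar> > c * (t - s)"
      using x by blast
    then show "\<exists>s t. (s, t) \<in> V \<and> s \<le> x \<and> x \<le> t \<and> t - s < d"
      by (intro exI[of _ s] exI[of _ t]) (auto simp: V_def d'_def)
  next
    fix F assume F: "F \<subseteq> V" "finite F"
      and dj: "pairwise (\<lambda>I J. disjnt {fst I..snd I} {fst J..snd J}) F"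
    have "pairwise (\<lambda>I J. disjnt {fst I<..<snd I} {fst J<..<snd J}) F"
      using dj by (rule pairwise_mono) (auto simp: disjnt_def)
    then have "nonoverlapping a b F" using F by (auto simp: nonoverlapping_def V_def)
    then have "(\<Sum>(s, t)\<in>F. \<bar>g t - g s\<bar>) \<le> B" by (rule bv)
    moreover have "c * (\<Sum>(s, t)\<in>F. t - s) \<le> (\<Sum>(s, t)\<in>F. \<bar>g t - g s\<bar>)"
      unfolding sum_distrib_left using F by (intro sum_mono) (auto simp: V_def)
    ultimately have "c * (\<Sum>(s, t)\<in>F. t - s) \<le> c * e"
      using \<open>e > 0\<close> by (simp add: c_def)
    then show "(\<Sum>(s, t)\<in>F. t - s) \<le> e" using \<open>c > 0\<close> by simp
  qed
  then show "\<exists>T. ?E \<subseteq> T \<and> T \<in> lmeasurable \<and> measure lebesgue T \<le> e" by blast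
qed

text \<open>Lebesgue's theorem.  Where \<open>f\<close> has no derivative, either the difference quotients are unbounded, or they lie
  below \<open>p\<close> and above \<open>q\<close> arbitrarily close to the point, for rational \<open>p < q\<close>.  Subtracting the linear
  function of slope \<open>(p + q) / 2\<close> turns the second case into oscillation between slopes \<open>\<plusminus> (q - p) / 2\<close>.\<close>
lemma bv_differentiable_ae:
  fixes f :: "real \<Rightarrow> real"
  assumes "a \<le> b"
    and bv: "\<And>D. nonoverlapping a b D \<Longrightarrow> (\<Sum>(s, t)\<in>D. \<bar>f t - f s\<bar>) \<le> B"
  shows "\<exists>N. negligible N \<and> (\<forall>x\<in>{a<..<b} - N. f differentiable (at x))"
proof -
  define E where "E m c = {x\<in>{a<..<b}. \<forall>d>0.
      (\<exists>s t. s \<le> x \<and> x \<le> t \<and> s < t \<and> t - s < d \<and> (f t - m * t) - (f s - m * s) > c * (t - s)) \<and>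
      (\<exists>s t. s \<le> x \<and> x \<le> t \<and> s < t \<and> t - s < d \<and> (f t - m * t) - (f s - m * s) < - c * (t - s))}"
    for m c
  define Einf where "Einf = {x\<in>{a<..<b}. \<forall>d>0. \<forall>c. \<exists>s t. s \<le> x \<and> x \<le> t \<and> s < t \<and> t - s < d \<and>
           \<bar>f t - f s\<bar> > c * (t - s)}"
  have E: "negligible (E m c)" if "c > 0" for m c
    unfolding E_def
  proof (rule bv_oscillation_negligible[OF \<open>a \<le> b\<close> that])
    fix D assume D: "nonoverlapping a b D"
    have "(\<Sum>(s, t)\<in>D. \<bar>(f t - m * t) - (f s - m * s)\<bar>) \<le>
        (\<Sum>(s, t)\<in>D. \<bar>f t - f s\<bar> + \<bar>m\<bar> * (t - s))"
    proof (intro sum_mono, clarify)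
      fix s t assume "(s, t) \<in> D"
      then have "s < t" using D by (auto simp: nonoverlapping_iff)
      have "(f t - m * t) - (f s - m * s) = (f t - f s) - m * (t - s)" by (simp add: algebra_simps)
      also have "\<bar>\<dots>\<bar> \<le> \<bar>f t - f s\<bar> + \<bar>m\<bar> * (t - s)"
        using abs_triangle_ineq4[of "f t - f s" "m * (t - s)"] \<open>s < t\<close> by (simp add: abs_mult)
      finally show "\<bar>(f t - m * t) - (f s - m * s)\<bar> \<le> \<bar>f t - f s\<bar> + \<bar>m\<bar> * (t - s)" .
    qed
    also have "\<dots> = (\<Sum>(s, t)\<in>D. \<bar>f t - f s\<bar>) + \<bar>m\<bar> * (\<Sum>(s, t)\<in>D. t - s)"
      by (simp add: sum.distrib sum_distrib_left split_beta)
    also have "(\<Sum>(s, t)\<in>D. t - s) \<le> b - a"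
      by (rule sum_increments_le[OF D \<open>a \<le> b\<close>]) (simp add: monotone_on_def)
    finally show "(\<Sum>(s, t)\<in>D. \<bar>(f t - m * t) - (f s - m * s)\<bar>) \<le> B + \<bar>m\<bar> * (b - a)"
      using bv[OF D] by (simp add: mult_left_mono)
  qed
  have Einf: "negligible Einf"
    unfolding Einf_def using bv by (rule bv_infinite_slope_negligible)
  let ?I = "{(p, q). p \<in> \<rat> \<and> q \<in> \<rat> \<and> p < (q :: real)}"
  define N where "N = Einf \<union> (\<Union>(p, q)\<in>?I. E ((p + q) / 2) ((q - p) / 2))"
  have "countable ?I" by (rule countable_subset[of _ "\<rat> \<times> \<rat>"]) (auto simp: countable_rat)
  have "negligible N"
    unfolding N_def
  proof (intro negligible_Un Einf negligible_countable_Union)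
    show "countable ((\<lambda>(p, q). E ((p + q) / 2) ((q - p) / 2)) ` ?I)"
      using \<open>countable ?I\<close> by simp
  qed (auto intro!: E)
  moreover have "f differentiable (at x)" if x: "x \<in> {a<..<b} - N" for x
  proof -
    define Q where "Q y = (f y - f x) / (y - x)" for y
    \<comment> \<open>Two-sided difference quotients at \<open>x\<close> as increments over intervals containing \<open>x\<close>.\<close>
    have incr: "\<exists>s t. s \<le> x \<and> x \<le> t \<and> s < t \<and> t - s = \<bar>y - x\<bar> \<and> f t - f s = Q y * (t - s)"
      if "y \<noteq> x" for y
    proof (cases "x < y")
      case True
      then show ?thesis by (intro exI[of _ x] exI[of _ y]) (simp add: Q_def)
    next
      case False
      then show ?thesis using that
        by (intro exI[of _ y] exI[of _ x]) (simp add: Q_def field_simps)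
    qed
    have shift: "(f t - m * t) - (f s - m * s) = (k - m) * (t - s)"
      if "f t - f s = k * (t - s)" for k m s t
      using that by (simp add: algebra_simps)
    from x have "x \<notin> Einf" by (simp add: N_def)
    then obtain d0 C where d0: "d0 > 0"
      and C: "\<And>s t. \<lbrakk>s \<le> x; x \<le> t; s < t; t - s < d0\<rbrakk> \<Longrightarrow> \<bar>f t - f s\<bar> \<le> C * (t - s)"
    proof -
      have "\<not> (\<forall>d>0. \<forall>c. \<exists>s t. s \<le> x \<and> x \<le> t \<and> s < t \<and> t - s < d \<and> \<bar>f t - f s\<bar> > c * (t - s))"
        using \<open>x \<notin> Einf\<close> x unfolding Einf_def by simp
      then obtain d0 C where "d0 > 0"
        "\<not> (\<exists>s t. s \<le> x \<and> x \<le> t \<and> s < t \<and> t - s < d0 \<and> \<bar>f t - f s\<bar> > C * (t - s))"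
        by blast
      then show ?thesis using that[of d0 C] by (meson not_less)
    qed
    have QC: "\<bar>Q y\<bar> \<le> C" if "y \<noteq> x" "\<bar>y - x\<bar> < d0" for y
    proof -
      obtain s t where st: "s \<le> x" "x \<le> t" "s < t" "t - s = \<bar>y - x\<bar>" "f t - f s = Q y * (t - s)"
        using incr[OF \<open>y \<noteq> x\<close>] by blast
      then have "\<bar>Q y\<bar> * (t - s) \<le> C * (t - s)" using C[of s t] that by (simp add: abs_mult)
      then show ?thesis using \<open>s < t\<close> by (metis diff_gt_0_iff_gt mult_le_cancel_right_pos)
    qed
    define A where "A = {m. \<exists>d>0. \<forall>y. y \<noteq> x \<and> \<bar>y - x\<bar> < d \<longrightarrow> Q y \<le> m}"
    have "C \<in> A" using QC d0 unfolding A_def by (auto simp: abs_le_iff)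
    have lower: "- C \<le> m" if "m \<in> A" for m
    proof -
      have "\<exists>d>0. \<forall>y. y \<noteq> x \<and> \<bar>y - x\<bar> < d \<longrightarrow> Q y \<le> m" using that by (simp add: A_def)
      then obtain d where d: "d > 0" "\<forall>y. y \<noteq> x \<and> \<bar>y - x\<bar> < d \<longrightarrow> Q y \<le> m" by blast
      define y where "y = x + min d d0 / 2"
      have y: "y \<noteq> x" "\<bar>y - x\<bar> < d" "\<bar>y - x\<bar> < d0" using d d0 by (auto simp: y_def)
      have "Q y \<le> m" using d(2) y by blast
      moreover have "- C \<le> Q y" using QC[OF y(1,3)] by simp
      ultimately show ?thesis by simp
    qed
    have bddA: "bdd_below A" by (rule bdd_belowI) (rule lower)
    define L where "L = Inf A"
    have "\<exists>d>0. \<forall>y. y \<noteq> x \<and> \<bar>y - x\<bar> < d \<longrightarrow> \<bar>Q y - L\<bar> \<le> e" if "e > 0" for e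
    proof -
      obtain m where "m \<in> A" "m < L + e"
        using cInf_less_iff[of A "L + e"] \<open>C \<in> A\<close> bddA \<open>e > 0\<close> unfolding L_def by auto
      then obtain d1 where d1: "d1 > 0" "\<And>y. y \<noteq> x \<Longrightarrow> \<bar>y - x\<bar> < d1 \<Longrightarrow> Q y \<le> L + e"
        unfolding A_def by fastforce
      obtain p where p: "p \<in> \<rat>" "L - e < p" "p < L - e / 2"
        using Rats_dense_in_real[of "L - e" "L - e / 2"] \<open>e > 0\<close> by auto
      obtain q where q: "q \<in> \<rat>" "L - e / 2 < q" "q < L"
        using Rats_dense_in_real[of "L - e / 2" L] \<open>e > 0\<close> by auto
      have "q \<notin> A" using q cInf_lower[OF _ bddA] unfolding L_def by force
      let ?m = "(p + q) / 2" and ?c = "(q - p) / 2"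
      have "x \<notin> E ?m ?c" using x p q by (force simp: N_def)
      then obtain d where d: "d > 0" and alt:
        "\<not> ((\<exists>s t. s \<le> x \<and> x \<le> t \<and> s < t \<and> t - s < d \<and> (f t - ?m * t) - (f s - ?m * s) > ?c * (t - s)) \<and>
            (\<exists>s t. s \<le> x \<and> x \<le> t \<and> s < t \<and> t - s < d \<and> (f t - ?m * t) - (f s - ?m * s) < - ?c * (t - s)))"
        using x unfolding E_def by blast
      have "\<exists>y. y \<noteq> x \<and> \<bar>y - x\<bar> < d \<and> q < Q y"
        using \<open>q \<notin> A\<close> d unfolding A_def by (auto simp: not_le)
      then obtain y where y: "y \<noteq> x" "\<bar>y - x\<bar> < d" "q < Q y" by blast
      obtain s t where st: "s \<le> x" "x \<le> t" "s < t" "t - s = \<bar>y - x\<bar>" "f t - f s = Q y * (t - s)"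
        using incr[OF y(1)] by blast
      have "(f t - ?m * t) - (f s - ?m * s) = (Q y - ?m) * (t - s)"
        using st(5) by (rule shift)
      moreover have "(Q y - ?m) * (t - s) > ?c * (t - s)"
        using y st by (intro mult_strict_right_mono) (auto simp: field_simps)
      ultimately have up: "(f t - ?m * t) - (f s - ?m * s) > ?c * (t - s)" by simp
      have low: "L - e \<le> Q y" if "y \<noteq> x" "\<bar>y - x\<bar> < d" for y
      proof (rule ccontr)
        assume "\<not> L - e \<le> Q y"
        then have "Q y < p" using p by simp
        obtain s' t' where st': "s' \<le> x" "x \<le> t'" "s' < t'" "t' - s' = \<bar>y - x\<bar>" "f t' - f s' = Q y * (t' - s')"
          using incr[OF \<open>y \<noteq> x\<close>] by blast
        have "(f t' - ?m * t') - (f s' - ?m * s') = (Q y - ?m) * (t' - s')"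
          using st'(5) by (rule shift)
        moreover have "(Q y - ?m) * (t' - s') < (- ?c) * (t' - s')"
          using \<open>Q y < p\<close> st' by (intro mult_strict_right_mono) (auto simp: field_simps)
        ultimately have "(f t' - ?m * t') - (f s' - ?m * s') < - ?c * (t' - s')" by simp
        moreover have "t - s < d" "t' - s' < d" using st st' y that by auto
        ultimately show False using alt up st st' by blast
      qed
      show ?thesis
        using d d1 low by (intro exI[of _ "min d d1"]) (fastforce simp: abs_le_iff)
    qed
    note approx = this
    have "(Q \<longlongrightarrow> L) (at x)"
    proof (rule tendstoI)
      fix e :: real assume "e > 0"
      then obtain d where "d > 0" "\<And>y. y \<noteq> x \<Longrightarrow> \<bar>y - x\<bar> < d \<Longrightarrow> \<bar>Q y - L\<bar> \<le> e / 2"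
        using approx[of "e / 2"] by auto
      then show "\<forall>\<^sub>F y in at x. dist (Q y) L < e"
        unfolding eventually_at using \<open>e > 0\<close> by (intro exI[of _ d]) (fastforce simp: dist_real_def)
    qed
    then have "(f has_real_derivative L) (at x)"
      unfolding has_field_derivative_iff Q_def .
    then show ?thesis by (auto simp: real_differentiable_def)
  qed
  ultimately show ?thesis by blast
qed

lemma bv_differentiable_ae_vector:
  fixes f :: "real \<Rightarrow> 'a::euclidean_space"
  assumes "a \<le> b"
    and bv: "\<And>D. nonoverlapping a b D \<Longrightarrow> (\<Sum>(s, t)\<in>D. norm (f t - f s)) \<le> B"
  shows "\<exists>N. negligible N \<and> (\<forall>x\<in>{a<..<b} - N. f differentiable (at x))"
proof -
  have "\<exists>N. negligible N \<and> (\<forall>x\<in>{a<..<b} - N. (\<lambda>x. f x \<bullet> i) differentiable (at x))" if "i \<in> Basis" for i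
  proof (rule bv_differentiable_ae[OF \<open>a \<le> b\<close>])
    fix D assume D: "nonoverlapping a b D"
    have "(\<Sum>(s, t)\<in>D. \<bar>f t \<bullet> i - f s \<bullet> i\<bar>) \<le> (\<Sum>(s, t)\<in>D. norm (f t - f s))"
      using Basis_le_norm[OF that] by (intro sum_mono) (auto simp: inner_diff_left[symmetric])
    with bv[OF D] show "(\<Sum>(s, t)\<in>D. \<bar>f t \<bullet> i - f s \<bullet> i\<bar>) \<le> B" by linarith
  qed
  then obtain N where N: "\<And>i. i \<in> Basis \<Longrightarrow> negligible (N i)"
    "\<And>i x. i \<in> Basis \<Longrightarrow> x \<in> {a<..<b} - N i \<Longrightarrow> (\<lambda>x. f x \<bullet> i) differentiable (at x)"
    by metis
  have "negligible (\<Union>(N ` Basis))" using N by (intro negligible_Union) auto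
  moreover have "f differentiable (at x)" if "x \<in> {a<..<b} - \<Union>(N ` Basis)" for x
    using N(2) that by (subst differentiable_componentwise_within) auto
  ultimately show ?thesis by blast
qed

section \<open>Absolutely continuous curves\<close>

lemma abs_continuous_on_iff:
  "abs_continuous_on a b f \<longleftrightarrow>
    (\<forall>e>0. \<exists>d>0. \<forall>D. nonoverlapping a b D \<and> (\<Sum>(s, t)\<in>D. t - s) < d \<longrightarrow>
       (\<Sum>(s, t)\<in>D. norm (f t - f s)) < e)"
  unfolding abs_continuous_on_def nonoverlapping_def by (simp add: conj_assoc)

lemma nonoverlapping_subinterval:
  "nonoverlapping u v D \<Longrightarrow> a \<le> u \<Longrightarrow> v \<le> b \<Longrightarrow> nonoverlapping a b D"
  unfolding nonoverlapping_iff by (meson order.trans)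

lemma abs_continuous_on_subinterval:
  "abs_continuous_on a b f \<Longrightarrow> a \<le> u \<Longrightarrow> v \<le> b \<Longrightarrow> abs_continuous_on u v f"
  unfolding abs_continuous_on_iff by (meson nonoverlapping_subinterval)

text \<open>Differentiability almost everywhere and absolute integrability of the derivative pass from short intervals to long
  ones (by the rule \<open>Bolzano\<close>), so it is enough to bound the variation locally.\<close>
lemma abs_continuous_on_locally_bv:
  assumes "abs_continuous_on a b f"
  obtains d where "d > 0"
    "\<And>u v D. \<lbrakk>a \<le> u; v \<le> b; v - u < d; nonoverlapping u v D\<rbrakk> \<Longrightarrow> (\<Sum>(s, t)\<in>D. norm (f t - f s)) \<le> 1"
proof -
  obtain d where d: "d > 0"
    "\<And>D. nonoverlapping a b D \<Longrightarrow> (\<Sum>(s, t)\<in>D. t - s) < d \<Longrightarrow> (\<Sum>(s, t)\<in>D. norm (f t - f s)) < 1"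
    using assms unfolding abs_continuous_on_iff by (metis zero_less_one)
  have "(\<Sum>(s, t)\<in>D. norm (f t - f s)) \<le> 1"
    if uv: "a \<le> u" "v \<le> b" "v - u < d" and D: "nonoverlapping u v D" for u v D
  proof (cases "u \<le> v")
    case True
    have "(\<Sum>(s, t)\<in>D. t - s) \<le> v - u"
      by (rule sum_increments_le[OF D True]) (simp add: monotone_on_def)
    then show ?thesis using d(2)[of D] nonoverlapping_subinterval[OF D] uv by simp
  next
    case False
    then have "D = {}" using D unfolding nonoverlapping_iff by fastforce
    then show ?thesis by simp
  qed
  then show ?thesis using that d(1) by blast
qed

theorem abs_continuous_on_differentiable_ae:
  fixes f :: "real \<Rightarrow> 'a::euclidean_space"
  assumes "abs_continuous_on a b f" "a \<le> b"
  shows "\<exists>N. negligible N \<and> (\<forall>x\<in>{a<..<b} - N. f differentiable (at x))"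
proof -
  obtain d where "d > 0" and d:
    "\<And>u v D. \<lbrakk>a \<le> u; v \<le> b; v - u < d; nonoverlapping u v D\<rbrakk> \<Longrightarrow> (\<Sum>(s, t)\<in>D. norm (f t - f s)) \<le> 1"
    using abs_continuous_on_locally_bv[OF assms(1)] by metis
  let ?P = "\<lambda>u v. a \<le> u \<longrightarrow> v \<le> b \<longrightarrow> (\<exists>N. negligible N \<and> (\<forall>x\<in>{u<..<v} - N. f differentiable (at x)))"
  have "?P a b"
  proof (rule Bolzano[of a b ?P, OF \<open>a \<le> b\<close>])
    fix u v w assume trans: "?P u v" "?P v w" "u \<le> v" "v \<le> w"
    show "?P u w"
    proof (intro impI)
      assume "a \<le> u" "w \<le> b"
      then obtain N N' where N: "negligible N" "\<forall>x\<in>{u<..<v} - N. f differentiable (at x)"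
          "negligible N'" "\<forall>x\<in>{v<..<w} - N'. f differentiable (at x)"
        using trans by auto
      have "negligible (insert v (N \<union> N'))" using N by (simp add: negligible_insert)
      moreover have "f differentiable (at x)" if "x \<in> {u<..<w} - insert v (N \<union> N')" for x
        using that N by (cases "x < v") auto
      ultimately show "\<exists>N. negligible N \<and> (\<forall>x\<in>{u<..<w} - N. f differentiable (at x))"
        by blast
    qed
  next
    fix x assume "a \<le> x" "x \<le> b"
    have "?P u v" if "u \<le> x" "x \<le> v" "v - u < d" for u v
      using that d[of u v] by (intro impI bv_differentiable_ae_vector[of u v f 1]) auto
    then show "\<exists>d>0. \<forall>u v. u \<le> x \<and> x \<le> v \<and> v - u < d \<longrightarrow> ?P u v"
      using \<open>d > 0\<close> by blast
  qed
  then show ?thesis by simp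
qed

text \<open>The cells of a division may be single points, which have to be dropped to get a
  non-overlapping family of pairs; they do not contribute to the variation.  The index type serves for divisions
  and for tagged divisions alike.\<close>
lemma nonoverlapping_nondegenerate:
  fixes K :: "'i \<Rightarrow> real set" and f :: "real \<Rightarrow> 'a::real_normed_vector"
  assumes fin: "finite p"
    and K: "\<And>i. i \<in> p \<Longrightarrow> \<exists>s t. K i = {s..t} \<and> s \<le> t \<and> a \<le> s \<and> t \<le> b"
    and disj: "\<And>i j. i \<in> p \<Longrightarrow> j \<in> p \<Longrightarrow> i \<noteq> j \<Longrightarrow> interior (K i) \<inter> interior (K j) = {}"
  defines "D \<equiv> (\<lambda>i. (Inf (K i), Sup (K i))) ` {i\<in>p. Inf (K i) < Sup (K i)}"
  shows "nonoverlapping a b D"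
    and "(\<Sum>(s, t)\<in>D. norm (f t - f s)) = (\<Sum>i\<in>p. norm (f (Sup (K i)) - f (Inf (K i))))"
proof -
  let ?q = "{i\<in>p. Inf (K i) < Sup (K i)}"
  let ?e = "\<lambda>i. (Inf (K i), Sup (K i))"
  have sep: "?e i \<noteq> ?e j \<and> (Sup (K i) \<le> Inf (K j) \<or> Sup (K j) \<le> Inf (K i))"
    if ij: "i \<in> ?q" "j \<in> ?q" "i \<noteq> j" for i j
  proof -
    obtain u v where uv: "K i = {u..v}" "u \<le> v" using K[of i] ij by auto
    obtain s t where st: "K j = {s..t}" "s \<le> t" using K[of j] ij by auto
    have "disjnt {u<..<v} {s<..<t}" using disj[of i j] ij uv st by (simp add: disjnt_def)
    moreover have "u < v" "s < t" using ij uv st by auto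
    ultimately have "v \<le> s \<or> t \<le> u" using disjnt_open_intervals_iff by blast
    then show ?thesis using uv st \<open>u < v\<close> \<open>s < t\<close> by auto
  qed
  show "nonoverlapping a b D"
  proof (subst nonoverlapping_iff, intro conjI allI impI)
    show "finite D" using fin by (simp add: D_def)
    fix s t assume "(s, t) \<in> D"
    then obtain i where i: "i \<in> ?q" "s = Inf (K i)" "t = Sup (K i)" by (auto simp: D_def)
    then obtain u v where "K i = {u..v}" "u \<le> v" "a \<le> u" "v \<le> b" using K[of i] by auto
    then show "a \<le> s" "s < t" "t \<le> b" using i by auto
    fix u v assume "(u, v) \<in> D" "(s, t) \<noteq> (u, v)"
    then obtain j where "j \<in> ?q" "u = Inf (K j)" "v = Sup (K j)" by (auto simp: D_def)
    then show "t \<le> u \<or> v \<le> s" using sep[OF i(1), of j] i \<open>(s, t) \<noteq> (u, v)\<close> by auto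
  qed
  have "inj_on ?e ?q" using sep by (auto simp: inj_on_def)
  then have "(\<Sum>(s, t)\<in>D. norm (f t - f s)) = (\<Sum>i\<in>?q. norm (f (Sup (K i)) - f (Inf (K i))))"
    unfolding D_def by (subst sum.reindex) (simp_all add: o_def)
  also have "\<dots> = (\<Sum>i\<in>p. norm (f (Sup (K i)) - f (Inf (K i))))"
  proof (rule sum.mono_neutral_left[OF fin])
    show "\<forall>i\<in>p - ?q. norm (f (Sup (K i)) - f (Inf (K i))) = 0"
    proof
      fix i assume i: "i \<in> p - ?q"
      then obtain s t where "K i = {s..t}" "s \<le> t" using K[of i] by auto
      then show "norm (f (Sup (K i)) - f (Inf (K i))) = 0" using i by auto
    qed
  qed auto
  finally show "(\<Sum>(s, t)\<in>D. norm (f t - f s)) = (\<Sum>i\<in>p. norm (f (Sup (K i)) - f (Inf (K i))))" .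
qed

text \<open>A gauge argument.  Tags outside \<open>N\<close> are handled by differentiability, as in the usual fundamental theorem.  Around
  points of \<open>N\<close> the gauge keeps the cells inside an open set of measure less than \<open>\<delta>\<close>, so
  that absolute continuity bounds the sum of the increments over the cells tagged in \<open>N\<close>.\<close>
theorem abs_continuous_on_has_integral_derivative:
  fixes f :: "real \<Rightarrow> 'a::euclidean_space"
  assumes ac: "abs_continuous_on a b f" and "a \<le> b" and N: "negligible N"
    and deriv: "\<And>x. x \<in> {a..b} - N \<Longrightarrow> (f has_vector_derivative f' x) (at x within {a..b})"
  shows "(f' has_integral (f b - f a)) {a..b}"
proof -
  define g where "g x = (if x \<in> N then 0 else f' x)" for x
  have "(g has_integral (f b - f a)) (cbox a b)"
    unfolding has_integral
  proof (intro allI impI)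
    fix e :: real assume "e > 0"
    obtain \<delta> where "\<delta> > 0" and \<delta>:
      "\<And>D. nonoverlapping a b D \<Longrightarrow> (\<Sum>(s, t)\<in>D. t - s) < \<delta> \<Longrightarrow> (\<Sum>(s, t)\<in>D. norm (f t - f s)) < e / 2"
      using ac \<open>e > 0\<close> unfolding abs_continuous_on_iff by (meson half_gt_zero)
    obtain U where U: "open U" "N \<subseteq> U" "U \<in> lmeasurable" "measure lebesgue U < \<delta>"
    proof -
      have "N \<in> sets lebesgue" using N by (simp add: negligible_imp_sets)
      then obtain U where U: "open U" "N \<subseteq> U" "U - N \<in> lmeasurable" "emeasure lebesgue (U - N) < ennreal \<delta>"
        using sets_lebesgue_outer_open[OF _ \<open>\<delta> > 0\<close>] by blast
      have NN: "N \<in> lmeasurable" "measure lebesgue N = 0"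
        using N by (simp_all add: negligible_imp_measurable negligible_imp_measure0)
      have eq: "U = (U - N) \<union> N" using U by blast
      have "U \<in> lmeasurable" using fmeasurable.Un[OF U(3) NN(1)] eq by simp
      moreover have "measure lebesgue (U - N) < \<delta>"
        using U(3,4) \<open>\<delta> > 0\<close> by (simp add: emeasure_eq_measure2 ennreal_less_iff)
      moreover have "measure lebesgue U \<le> measure lebesgue (U - N) + measure lebesgue N"
        using measure_Un_le[of "U - N" lebesgue N] U(3) NN(1) eq by (metis fmeasurableD)
      ultimately show ?thesis using that[of U] U NN by simp
    qed
    define \<eta> where "\<eta> = e / (2 * (b - a + 1))"
    have "\<eta> > 0" using \<open>e > 0\<close> \<open>a \<le> b\<close> by (simp add: \<eta>_def)
    have "\<exists>d>0. (x \<in> N \<longrightarrow> ball x d \<subseteq> U) \<and> (x \<in> {a..b} - N \<longrightarrow>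
         (\<forall>y\<in>{a..b}. norm (y - x) < d \<longrightarrow> norm (f y - f x - (y - x) *\<^sub>R f' x) \<le> \<eta> * norm (y - x)))" for x
    proof (cases "x \<in> N")
      case True
      then obtain d where "d > 0" "ball x d \<subseteq> U" using U openE by blast
      with True show ?thesis by blast
    next
      case False
      show ?thesis
      proof (cases "x \<in> {a..b}")
        case True
        with deriv[of x] False have "(f has_derivative (\<lambda>h. h *\<^sub>R f' x)) (at x within {a..b})"
          by (simp add: has_vector_derivative_def)
        then obtain d where "d > 0"
          "\<forall>y\<in>{a..b}. norm (y - x) < d \<longrightarrow> norm (f y - f x - (y - x) *\<^sub>R f' x) \<le> \<eta> * norm (y - x)"
          using \<open>\<eta> > 0\<close> unfolding has_derivative_within_alt by blast
        with False show ?thesis by blast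
      qed (use False in \<open>auto intro: exI[of _ 1]\<close>)
    qed
    then obtain d where d: "\<And>x. d x > 0" "\<And>x. x \<in> N \<Longrightarrow> ball x (d x) \<subseteq> U"
      "\<And>x y. \<lbrakk>x \<in> {a..b} - N; y \<in> {a..b}; norm (y - x) < d x\<rbrakk> \<Longrightarrow>
          norm (f y - f x - (y - x) *\<^sub>R f' x) \<le> \<eta> * norm (y - x)"
      by metis
    show "\<exists>\<gamma>. gauge \<gamma> \<and> (\<forall>p. p tagged_division_of cbox a b \<and> \<gamma> fine p \<longrightarrow>
        norm ((\<Sum>(x, K)\<in>p. measure lborel K *\<^sub>R g x) - (f b - f a)) < e)"
    proof (rule exI, safe)
      show "gauge (\<lambda>x. ball x (d x))" using d(1) gauge_ball_dependent by blast
    next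
      fix p assume p: "p tagged_division_of cbox a b" and fine: "(\<lambda>x. ball x (d x)) fine p"
      have finp: "finite p" using p by blast
      have sum1: "b - a = (\<Sum>(x, K)\<in>p. Sup K - Inf K)" and sumf: "f b - f a = (\<Sum>(x, K)\<in>p. f (Sup K) - f (Inf K))"
        using additive_tagged_division_1[where f= "\<lambda>x. x"] additive_tagged_division_1[where f= f]
            \<open>a \<le> b\<close> p by auto
      have K: "\<exists>u v. K = {u..v} \<and> u \<le> x \<and> x \<le> v \<and> a \<le> u \<and> v \<le> b \<and> K \<subseteq> ball x (d x)"
        if xK: "(x, K) \<in> p" for x K
      proof -
        obtain u v where "K = {u..v}" using p xK by (metis tagged_division_ofD(4) box_real(2))
        moreover have "x \<in> K" "K \<subseteq> {a..b}" using p xK by (auto dest: tagged_division_ofD)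
        moreover have "K \<subseteq> ball x (d x)" using fine xK by (auto simp: fine_def)
        ultimately show ?thesis by auto
      qed
      let ?D = "\<lambda>(x, K). measure lborel K *\<^sub>R g x - (f (Sup K) - f (Inf K))"
      have good: "norm (?D (x, K)) \<le> \<eta> * (Sup K - Inf K)" if xK: "(x, K) \<in> p" "x \<notin> N" for x K
      proof -
        obtain u v where uv: "K = {u..v}" "u \<le> x" "x \<le> v" "a \<le> u" "v \<le> b" "{u..v} \<subseteq> ball x (d x)"
          using K[OF xK(1)] by blast
        have x: "x \<in> {a..b} - N" using uv xK by auto
        have "u \<in> {u..v}" "v \<in> {u..v}" using uv(2,3) by auto
        then have "u \<in> ball x (d x)" "v \<in> ball x (d x)" using uv(6) by blast+
        then have "norm (u - x) < d x" "norm (v - x) < d x" by (simp_all add: dist_real_def)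
        then have u: "norm (f u - f x - (u - x) *\<^sub>R f' x) \<le> \<eta> * (x - u)"
          and v: "norm (f v - f x - (v - x) *\<^sub>R f' x) \<le> \<eta> * (v - x)"
          using d(3)[OF x, of u] d(3)[OF x, of v] uv by auto
        have "?D (x, K) = (f u - f x - (u - x) *\<^sub>R f' x) - (f v - f x - (v - x) *\<^sub>R f' x)"
          using uv xK by (simp add: g_def algebra_simps)
        also have "norm \<dots> \<le> \<eta> * (x - u) + \<eta> * (v - x)"
          using norm_triangle_ineq4[of "f u - f x - (u - x) *\<^sub>R f' x" "f v - f x - (v - x) *\<^sub>R f' x"] u v
          by simp
        finally show ?thesis using uv by (simp add: algebra_simps)
      qed
      define p1 where "p1 = {(x, K)\<in>p. x \<notin> N}"
      define p2 where "p2 = {(x, K)\<in>p. x \<in> N}"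
      have fin: "finite p1" "finite p2"
        using finp by (auto simp: p1_def p2_def intro: finite_subset[OF _ finp])
      have p12: "p = p1 \<union> p2" "p1 \<inter> p2 = {}" by (auto simp: p1_def p2_def)
      have "norm (\<Sum>I\<in>p1. ?D I) \<le> (\<Sum>(x, K)\<in>p1. \<eta> * (Sup K - Inf K))"
        using good by (intro sum_norm_le) (auto simp: p1_def)
      also have "\<dots> \<le> (\<Sum>(x, K)\<in>p. \<eta> * (Sup K - Inf K))"
      proof (rule sum_mono2[OF finp])
        fix I assume "I \<in> p - p1"
        then obtain x K' where "I = (x, K')" "(x, K') \<in> p" by (cases I) auto
        then show "0 \<le> (case I of (x, K) \<Rightarrow> \<eta> * (Sup K - Inf K))"
          using K[of x K'] \<open>\<eta> > 0\<close> by auto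
      qed (auto simp: p12)
      also have "\<dots> = \<eta> * (b - a)" by (simp add: sum1 sum_distrib_left split_beta)
      also have "\<dots> < e / 2" using \<open>e > 0\<close> \<open>a \<le> b\<close> by (simp add: \<eta>_def field_simps)
      finally have bound1: "norm (\<Sum>I\<in>p1. ?D I) < e / 2" .
      define D where "D = (\<lambda>I. (Inf (snd I), Sup (snd I))) ` {I\<in>p2. Inf (snd I) < Sup (snd I)}"
      have no: "nonoverlapping a b D"
        and sumD: "(\<Sum>(s, t)\<in>D. norm (f t - f s)) = (\<Sum>I\<in>p2. norm (f (Sup (snd I)) - f (Inf (snd I))))"
      proof -
        have K2: "\<exists>s t. snd I = {s..t} \<and> s \<le> t \<and> a \<le> s \<and> t \<le> b" if "I \<in> p2" for I
          using K[of "fst I" "snd I"] that by (force simp: p2_def)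
        have disj: "interior (snd I) \<inter> interior (snd J) = {}" if "I \<in> p2" "J \<in> p2" "I \<noteq> J" for I J
          using tagged_division_ofD(5)[OF p, of "fst I" "snd I" "fst J" "snd J"] that
          by (auto simp: p2_def prod_eq_iff)
        show "nonoverlapping a b D"
          unfolding D_def by (rule nonoverlapping_nondegenerate(1)[OF fin(2) K2 disj])
        show "(\<Sum>(s, t)\<in>D. norm (f t - f s)) = (\<Sum>I\<in>p2. norm (f (Sup (snd I)) - f (Inf (snd I))))"
          unfolding D_def by (rule nonoverlapping_nondegenerate(2)[OF fin(2) K2 disj])
      qed
      have "(\<Sum>(s, t)\<in>D. t - s) < \<delta>"
      proof -
        have "(\<Sum>(s, t)\<in>D. t - s) = (\<Sum>I\<in>D. measure lebesgue {fst I<..<snd I})"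
          by (intro sum.cong refl) (auto simp: D_def)
        also have "\<dots> = measure lebesgue (\<Union>I\<in>D. {fst I<..<snd I})"
          using no unfolding nonoverlapping_def by (intro measure_UNION'[symmetric]) auto
        also have "\<dots> \<le> measure lebesgue U"
        proof (rule measure_mono_fmeasurable[OF _ _ U(3)])
          show "(\<Union>I\<in>D. {fst I<..<snd I}) \<subseteq> U"
          proof
            fix y assume "y \<in> (\<Union>I\<in>D. {fst I<..<snd I})"
            then obtain x L where xL: "(x, L) \<in> p2" and y: "Inf L < y" "y < Sup L"
              by (auto simp: D_def)
            obtain u v where "L = {u..v}" "u \<le> x" "x \<le> v" "L \<subseteq> ball x (d x)"
              using K[of x L] xL by (auto simp: p2_def)
            moreover have "x \<in> N" using xL by (auto simp: p2_def)
            moreover have "y \<in> {u..v}" using y \<open>L = {u..v}\<close> \<open>u \<le> x\<close> \<open>x \<le> v\<close> by simp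
            ultimately show "y \<in> U" using d(2)[of x] by blast
          qed
          show "(\<Union>I\<in>D. {fst I<..<snd I}) \<in> sets lebesgue"
            using fin by (intro sets.finite_UN) (auto simp: D_def)
        qed
        also have "\<dots> < \<delta>" by fact
        finally show ?thesis .
      qed
      with no have "(\<Sum>(s, t)\<in>D. norm (f t - f s)) < e / 2" by (rule \<delta>)
      then have "(\<Sum>(x, K)\<in>p2. norm (f (Sup K) - f (Inf K))) < e / 2"
        unfolding sumD by (simp add: split_beta)
      moreover have "norm (\<Sum>I\<in>p2. ?D I) \<le> (\<Sum>(x, K)\<in>p2. norm (f (Sup K) - f (Inf K)))"
        by (intro sum_norm_le) (auto simp: p2_def g_def norm_minus_commute)
      ultimately have bound2: "norm (\<Sum>I\<in>p2. ?D I) < e / 2" by simp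
      have "(\<Sum>(x, K)\<in>p. measure lborel K *\<^sub>R g x) - (f b - f a) = (\<Sum>I\<in>p. ?D I)"
        unfolding sumf by (simp add: sum_subtractf split_beta)
      also have "\<dots> = (\<Sum>I\<in>p1. ?D I) + (\<Sum>I\<in>p2. ?D I)"
        unfolding p12(1) using fin p12(2) by (intro sum.union_disjoint) auto
      also have "norm \<dots> < e"
        using norm_triangle_ineq[of "\<Sum>I\<in>p1. ?D I" "\<Sum>I\<in>p2. ?D I"] bound1 bound2 by linarith
      finally show "norm ((\<Sum>(x, K)\<in>p. measure lborel K *\<^sub>R g x) - (f b - f a)) < e" .
    qed
  qed
  then have "(g has_integral (f b - f a)) {a..b}" by simp
  then show ?thesis
    by (rule has_integral_spike[OF N, rotated]) (auto simp: g_def)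
qed

text \<open>An integrable function is absolutely integrable if its indefinite integral, here \<open>f\<close>, has bounded variation.\<close>
theorem abs_continuous_on_absolutely_integrable_derivative:
  fixes f :: "real \<Rightarrow> 'a::euclidean_space"
  assumes ac: "abs_continuous_on a b f" and "a \<le> b" and N: "negligible N"
    and deriv: "\<And>x. x \<in> {a..b} - N \<Longrightarrow> (f has_vector_derivative f' x) (at x within {a..b})"
  shows "f' absolutely_integrable_on {a..b}"
proof -
  have ftc: "(f' has_integral (f v - f u)) {u..v}" if "a \<le> u" "u \<le> v" "v \<le> b" for u v
  proof (rule abs_continuous_on_has_integral_derivative[OF _ that(2) N])
    show "abs_continuous_on u v f" using abs_continuous_on_subinterval[OF ac] that by simp
    fix x assume "x \<in> {u..v} - N"
    then show "(f has_vector_derivative f' x) (at x within {u..v})"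
      using that by (intro has_vector_derivative_within_subset[OF deriv]) auto
  qed
  obtain d where "d > 0" and d:
    "\<And>u v D. \<lbrakk>a \<le> u; v \<le> b; v - u < d; nonoverlapping u v D\<rbrakk> \<Longrightarrow> (\<Sum>(s, t)\<in>D. norm (f t - f s)) \<le> 1"
    using abs_continuous_on_locally_bv[OF ac] by metis
  let ?P = "\<lambda>u v. a \<le> u \<longrightarrow> v \<le> b \<longrightarrow> f' absolutely_integrable_on {u..v}"
  have "?P a b"
  proof (rule Bolzano[of a b ?P, OF \<open>a \<le> b\<close>])
    fix u v w assume "?P u v" "?P v w" "u \<le> v" "v \<le> w"
    then show "?P u w" by (auto intro: absolutely_integrable_on_combine)
  next
    fix x assume "a \<le> x" "x \<le> b"
    have "f' absolutely_integrable_on {u..v}"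
      if uv: "u \<le> x" "x \<le> v" "v - u < d" "a \<le> u" "v \<le> b" for u v
      unfolding box_real(2)[symmetric]
    proof (rule bounded_variation_absolutely_integrable_interval)
      show "f' integrable_on cbox u v" using ftc[of u v] uv by auto
      fix p assume p: "p division_of cbox u v"
      have finp: "finite p" using p by blast
      have K: "\<exists>s t. K = {s..t} \<and> s \<le> t \<and> u \<le> s \<and> t \<le> v" if "K \<in> p" for K
      proof -
        have "\<exists>s t. K = cbox s t" "K \<noteq> {}" "K \<subseteq> cbox u v"
          using division_ofD(2-4)[OF p] that by blast+
        then obtain s t where "K = {s..t}" "{s..t} \<noteq> {}" "{s..t} \<subseteq> {u..v}" by auto
        then have "s \<le> t \<and> u \<le> s \<and> t \<le> v" by simp
        with \<open>K = {s..t}\<close> show ?thesis by blast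
      qed
      define D where "D = (\<lambda>K. (Inf K, Sup K)) ` {K\<in>p. Inf K < Sup K}"
      have "nonoverlapping u v D"
        unfolding D_def by (rule nonoverlapping_nondegenerate(1)[OF finp K division_ofD(5)[OF p]])
      then have "(\<Sum>(s, t)\<in>D. norm (f t - f s)) \<le> 1" using d[of u v] uv by blast
      moreover have "(\<Sum>(s, t)\<in>D. norm (f t - f s)) = (\<Sum>K\<in>p. norm (f (Sup K) - f (Inf K)))"
        unfolding D_def by (rule nonoverlapping_nondegenerate(2)[OF finp K division_ofD(5)[OF p]])
      moreover have "(\<Sum>K\<in>p. norm (f (Sup K) - f (Inf K))) = (\<Sum>K\<in>p. norm (integral K f'))"
      proof (intro sum.cong refl)
        fix L assume "L \<in> p"
        then obtain s t where "L = {s..t}" "s \<le> t" "u \<le> s" "t \<le> v" using K[of L] by auto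
        then show "norm (f (Sup L) - f (Inf L)) = norm (integral L f')"
          using integral_unique[OF ftc[of s t]] uv by simp
      qed
      ultimately show "(\<Sum>K\<in>p. norm (integral K f')) \<le> 1" by simp
    qed
    then show "\<exists>d>0. \<forall>u v. u \<le> x \<and> x \<le> v \<and> v - u < d \<longrightarrow> ?P u v"
      using \<open>d > 0\<close> by blast
  qed
  then show ?thesis by simp
qed

lemma indefinite_integral_diff:
  fixes u :: "real \<Rightarrow> 'a::banach"
  assumes "u integrable_on {a..b}" "a \<le> s" "s \<le> t" "t \<le> b"
  shows "integral {a..t} u - integral {a..s} u = integral {s..t} u"
proof -
  have "u integrable_on {a..t}"
    using assms by (intro integrable_on_subinterval[OF assms(1)]) auto
  then have "integral {a..s} u + integral {s..t} u = integral {a..t} u"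
    using assms by (intro Henstock_Kurzweil_Integration.integral_combine) auto
  then show ?thesis by (simp add: algebra_simps)
qed

text \<open>Cut \<open>norm \<circ> u\<close> off at a height \<open>n\<close> for which the part above \<open>n\<close> has integral less than \<open>e / 2\<close>; the part
  below contributes at most \<open>n\<close> times the total length of the intervals.\<close>
theorem abs_continuous_on_indefinite_integral:
  fixes u :: "real \<Rightarrow> 'a::euclidean_space"
  assumes u: "u absolutely_integrable_on {a..b}"
  shows "abs_continuous_on a b (\<lambda>t. p + integral {a..t} u)"
  unfolding abs_continuous_on_iff
proof (intro allI impI)
  fix e :: real assume "e > 0"
  define m where "m n x = min (norm (u x)) (real n)" for n x
  have nu: "(\<lambda>x. norm (u x)) absolutely_integrable_on {a..b}"
    using u by (simp add: absolutely_integrable_norm[unfolded o_def])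
  have mint: "m n absolutely_integrable_on {a..b}" for n
    unfolding m_def
    by (rule absolutely_integrable_min_1[OF nu absolutely_integrable_continuous_real]) simp
  have "(\<lambda>n. integral {a..b} (m n)) \<longlonglongrightarrow> integral {a..b} (\<lambda>x. norm (u x))"
  proof (rule dominated_convergence(2)[where h = "\<lambda>x. norm (u x)"])
    show "m n integrable_on {a..b}" for n
      using mint by (rule set_lebesgue_integral_eq_integral(1))
    show "(\<lambda>x. norm (u x)) integrable_on {a..b}"
      using nu by (rule set_lebesgue_integral_eq_integral(1))
    show "norm (m n x) \<le> norm (u x)" for n x by (simp add: m_def)
    show "(\<lambda>n. m n x) \<longlonglongrightarrow> norm (u x)" for x
    proof (rule tendsto_eventually)
      obtain k :: nat where "norm (u x) \<le> real k" using real_arch_simple by blast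
      then show "\<forall>\<^sub>F n in sequentially. m n x = norm (u x)"
        unfolding eventually_sequentially m_def by (intro exI[of _ k]) auto
    qed
  qed
  then obtain n where n: "\<bar>integral {a..b} (m n) - integral {a..b} (\<lambda>x. norm (u x))\<bar> < e / 2"
    using \<open>e > 0\<close> unfolding LIMSEQ_iff by (metis half_gt_zero order_refl real_norm_def)
  define h where "h x = norm (u x) - m n x" for x
  have inth: "h integrable_on {a..b}" and intm: "m n integrable_on {a..b}"
      and intnu: "(\<lambda>x. norm (u x)) integrable_on {a..b}"
    unfolding h_def using nu mint set_lebesgue_integral_eq_integral(1) by (blast intro: integrable_diff)+
  have h0: "h x \<ge> 0" for x by (simp add: h_def m_def)
  define H where "H t = integral {a..t} h" for t
  define d where "d = e / (2 * (real n + 1))"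
  have "d > 0" using \<open>e > 0\<close> by (simp add: d_def)
  show "\<exists>d>0. \<forall>D. nonoverlapping a b D \<and> (\<Sum>(s, t)\<in>D. t - s) < d \<longrightarrow>
       (\<Sum>(s, t)\<in>D. norm ((p + integral {a..t} u) - (p + integral {a..s} u))) < e"
  proof (intro exI[of _ d] conjI allI impI, fact)
    fix D assume "nonoverlapping a b D \<and> (\<Sum>(s, t)\<in>D. t - s) < d"
    then have D: "nonoverlapping a b D" and len: "(\<Sum>(s, t)\<in>D. t - s) < d" by auto
    show "(\<Sum>(s, t)\<in>D. norm ((p + integral {a..t} u) - (p + integral {a..s} u))) < e"
    proof (cases "a \<le> b")
      case False
      then have "D = {}" using D unfolding nonoverlapping_iff by fastforce
      then show ?thesis using \<open>e > 0\<close> by simp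
    next
      case True
      have "(\<Sum>(s, t)\<in>D. norm ((p + integral {a..t} u) - (p + integral {a..s} u))) \<le>
          (\<Sum>(s, t)\<in>D. (H t - H s) + real n * (t - s))"
      proof (intro sum_mono, clarify)
        fix s t assume "(s, t) \<in> D"
        then have st: "a \<le> s" "s < t" "t \<le> b" using D by (auto simp: nonoverlapping_iff)
        have sub: "{s..t} \<subseteq> {a..b}" using st by auto
        have "norm ((p + integral {a..t} u) - (p + integral {a..s} u)) = norm (integral {s..t} u)"
          using indefinite_integral_diff[OF set_lebesgue_integral_eq_integral(1)[OF u], of s t] st by simp
        also have "\<dots> \<le> integral {s..t} (\<lambda>x. norm (u x))"
          using sub absolutely_integrable_on_subinterval[OF u sub]
          by (intro integral_norm_bound_integral) (auto simp: absolutely_integrable_on_def)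
        also have "\<dots> = integral {s..t} h + integral {s..t} (m n)"
          using integral_add[of h "{s..t}" "m n"] integrable_on_subinterval[OF inth sub]
            integrable_on_subinterval[OF intm sub] by (simp add: h_def)
        also have "integral {s..t} h = H t - H s"
          unfolding H_def using indefinite_integral_diff[OF inth] st by simp
        also have "integral {s..t} (m n) \<le> integral {s..t} (\<lambda>x. real n)"
          using integrable_on_subinterval[OF intm sub] by (intro integral_le) (auto simp: m_def)
        also have "\<dots> = real n * (t - s)" using st by simp
        finally show "norm ((p + integral {a..t} u) - (p + integral {a..s} u)) \<le> (H t - H s) + real n * (t - s)"
          by simp
      qed
      also have "\<dots> = (\<Sum>(s, t)\<in>D. H t - H s) + real n * (\<Sum>(s, t)\<in>D. t - s)"
        by (simp add: sum.distrib sum_distrib_left split_beta)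
      also have "(\<Sum>(s, t)\<in>D. H t - H s) \<le> H b - H a"
      proof (rule sum_increments_le[OF D True])
        show "mono_on {a..b} H"
        proof (rule mono_onI)
          fix s t assume st: "s \<in> {a..b}" "t \<in> {a..b}" "s \<le> t"
          then have sub: "{s..t} \<subseteq> {a..b}" by auto
          have "H t - H s = integral {s..t} h"
            unfolding H_def using indefinite_integral_diff[OF inth] st by simp
          also have "\<dots> \<ge> 0"
            using integrable_on_subinterval[OF inth sub] h0 by (intro integral_nonneg) auto
          finally show "H s \<le> H t" by simp
        qed
      qed
      also have "H b - H a = integral {a..b} (\<lambda>x. norm (u x)) - integral {a..b} (m n)"
        unfolding H_def h_def using intnu intm by (simp add: integral_diff)
      also have "\<dots> < e / 2" using n by linarith
      also have "real n * (\<Sum>(s, t)\<in>D. t - s) \<le> (real n + 1) * d"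
      proof (rule mult_mono)
        show "0 \<le> (\<Sum>(s, t)\<in>D. t - s)" using D by (intro sum_nonneg) (fastforce simp: nonoverlapping_iff)
      qed (use len in auto)
      also have "\<dots> = e / 2"
        using add_pos_nonneg[OF zero_less_one of_nat_0_le_iff[of n, where 'a = real]] by (simp add: d_def field_simps)
      finally show ?thesis by simp
    qed
  qed
qed

text \<open>Almost everywhere the indefinite integral has some derivative, and almost everywhere its right-sided difference
  quotients tend to \<open>u\<close>.\<close>
theorem indefinite_integral_has_derivative_ae:
  fixes u :: "real \<Rightarrow> 'a::euclidean_space"
  assumes u: "u absolutely_integrable_on {a..b}" and "a \<le> b"
  shows "\<exists>N. negligible N \<and> (\<forall>x\<in>{a<..<b} - N. ((\<lambda>t. p + integral {a..t} u) has_vector_derivative u x) (at x))"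
proof -
  let ?F = "\<lambda>t. p + integral {a..t} u"
  obtain N where N: "negligible N" "\<And>x. x \<in> {a<..<b} - N \<Longrightarrow> ?F differentiable (at x)"
    using abs_continuous_on_differentiable_ae[OF abs_continuous_on_indefinite_integral[OF u] \<open>a \<le> b\<close>]
    by metis
  have ui: "u integrable_on {a..b}" using u set_lebesgue_integral_eq_integral(1) by blast
  define w where "w x = (if x \<in> {a..b} then u x else 0)" for x
  have "w integrable_on cbox s t" for s t
  proof -
    have "w integrable_on UNIV" unfolding w_def using ui by (subst integrable_restrict_UNIV)
    then show ?thesis by (rule integrable_on_subcbox) simp
  qed
  then obtain M where M: "negligible M"
    "\<And>x e. x \<notin> M \<Longrightarrow> 0 < e \<Longrightarrow> \<exists>d>0. \<forall>h. 0 < h \<and> h < d \<longrightarrow>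
        norm (integral (cbox x (x + h *\<^sub>R One)) w /\<^sub>R h ^ DIM(real) - w x) < e"
    using integrable_ccontinuous_explicit by blast
  have "(?F has_vector_derivative u x) (at x)" if x: "x \<in> {a<..<b} - (N \<union> M)" for x
  proof -
    have "?F differentiable (at x)" using N x by blast
    then obtain v where v: "(?F has_vector_derivative v) (at x)"
      using vector_derivative_works by blast
    then have "((\<lambda>y. (?F y - ?F x) /\<^sub>R (y - x)) \<longlongrightarrow> v) (at x)"
    proof -
      have "((\<lambda>y. norm (?F y - ?F x - (y - x) *\<^sub>R v) / norm (y - x)) \<longlongrightarrow> 0) (at x)"
        using v by (simp add: has_vector_derivative_def has_derivative_iff_norm)
      moreover have "\<forall>\<^sub>F y in at x. norm (?F y - ?F x - (y - x) *\<^sub>R v) / norm (y - x) =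
          norm ((?F y - ?F x) /\<^sub>R (y - x) - v)"
        unfolding eventually_at_filter
      proof (intro always_eventually allI impI)
        fix y assume "y \<noteq> x"
        then have "(?F y - ?F x) /\<^sub>R (y - x) - v = (?F y - ?F x - (y - x) *\<^sub>R v) /\<^sub>R (y - x)"
          by (simp add: scaleR_diff_right)
        then show "norm (?F y - ?F x - (y - x) *\<^sub>R v) / norm (y - x) = norm ((?F y - ?F x) /\<^sub>R (y - x) - v)"
          by (simp add: divide_inverse_commute)
      qed
      ultimately have "((\<lambda>y. norm ((?F y - ?F x) /\<^sub>R (y - x) - v)) \<longlongrightarrow> 0) (at x)"
        by (rule Lim_transform_eventually)
      then show ?thesis unfolding tendsto_norm_zero_iff by (rule Lim_null[THEN iffD2])
    qed
    then have lim1: "((\<lambda>y. (?F y - ?F x) /\<^sub>R (y - x)) \<longlongrightarrow> v) (at_right x)"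
      by (rule filterlim_mono) (auto simp: at_le)
    have lim2: "((\<lambda>y. (?F y - ?F x) /\<^sub>R (y - x)) \<longlongrightarrow> u x) (at_right x)"
    proof (rule tendstoI)
      fix e :: real assume "e > 0"
      then obtain d where d: "d > 0"
        "\<And>h. 0 < h \<Longrightarrow> h < d \<Longrightarrow> norm (integral {x..x + h} w /\<^sub>R h - w x) < e"
        using M(2)[of x e] x by auto
      have "dist ((?F y - ?F x) /\<^sub>R (y - x)) (u x) < e" if y: "x < y" "y < min b (x + d)" for y
      proof -
        have "?F y - ?F x = integral {x..y} u"
          using indefinite_integral_diff[OF ui, of x y] x y by simp
        also have "\<dots> = integral {x..y} w"
          using x y by (intro integral_cong) (auto simp: w_def)
        finally show ?thesis using d(2)[of "y - x"] x y by (simp add: dist_norm w_def)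
      qed
      then show "\<forall>\<^sub>F y in at_right x. dist ((?F y - ?F x) /\<^sub>R (y - x)) (u x) < e"
        using x d unfolding eventually_at_right_field by (intro exI[of _ "min b (x + d)"]) auto
    qed
    have "v = u x" using tendsto_unique[OF _ lim1 lim2] by simp
    with v show ?thesis by simp
  qed
  moreover have "negligible (N \<union> M)" using N M by simp
  ultimately show ?thesis by blast
qed

section \<open>Horizontal lifts of planar curves\<close>

lemma hmult_nth [simp]:
  "(p \<star> q) $ 1 = p $ 1 + q $ 1" "(p \<star> q) $ 2 = p $ 2 + q $ 2"
  "(p \<star> q) $ 3 = p $ 3 + q $ 3 + (p $ 1 * q $ 2 - p $ 2 * q $ 1) / 2"
  by (simp_all add: hmult_def hbracket_def hZ_def axis_def)

lemma heis_eq_iff: "(p :: heis) = q \<longleftrightarrow> p $ 1 = q $ 1 \<and> p $ 2 = q $ 2 \<and> p $ 3 = q $ 3"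
  by (simp add: vec_eq_iff forall_3)

text \<open>The bracket of two horizontal vectors, as a real number.  The horizontal plane is identified with the complex
  numbers, so that \<open>norm\<close> is the sub-Riemannian length of a vector.\<close>
definition cross2 :: "complex \<Rightarrow> complex \<Rightarrow> real" where
  "cross2 z w = Re z * Im w - Im z * Re w"

lemma bilinear_cross2: "bilinear cross2"
  by (auto simp: bilinear_def cross2_def algebra_simps intro!: linearI)

lemma bounded_linear_cross2: "bounded_linear (cross2 z)"
  using bilinear_cross2 by (simp add: bilinear_def linear_conv_bounded_linear)

lemma cross2_simps [simp]:
  "cross2 0 w = 0" "cross2 z 0 = 0" "cross2 z z = 0"
  "cross2 (r *\<^sub>R z) w = r * cross2 z w" "cross2 z (r *\<^sub>R w) = r * cross2 z w"
  "cross2 (z + z') w = cross2 z w + cross2 z' w" "cross2 z (w + w') = cross2 z w + cross2 z w'"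
  "cross2 (- z) w = - cross2 z w" "cross2 z (- w) = - cross2 z w"
  by (simp_all add: cross2_def algebra_simps)

lemma abs_cross2_le: "\<bar>cross2 z w\<bar> \<le> norm z * norm w"
proof -
  have "cross2 z w = Im (cnj z * w)" by (simp add: cross2_def)
  also have "\<bar>\<dots>\<bar> \<le> norm (cnj z * w)" by (rule abs_Im_le_cmod)
  finally show ?thesis by (simp add: norm_mult)
qed

text \<open>The horizontal curve that starts at the identity at time \<open>a\<close> and has planar velocity \<open>u\<close>.  The height is
  the signed area swept by the planar curve, seen from its starting point.\<close>
definition hlift :: "real \<Rightarrow> (real \<Rightarrow> complex) \<Rightarrow> real \<Rightarrow> heis" where
  "hlift a u t = vector [Re (integral {a..t} u), Im (integral {a..t} u),
     integral {a..t} (\<lambda>s. cross2 (integral {a..s} u) (u s)) / 2]"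

lemma hlift_nth [simp]:
  "hlift a u t $ 1 = Re (integral {a..t} u)" "hlift a u t $ 2 = Im (integral {a..t} u)"
  "hlift a u t $ 3 = integral {a..t} (\<lambda>s. cross2 (integral {a..s} u) (u s)) / 2"
  by (simp_all add: hlift_def)

lemma absolutely_integrable_swept_area:
  fixes u :: "real \<Rightarrow> complex"
  assumes u: "u absolutely_integrable_on {a..b}"
  shows "(\<lambda>s. cross2 (c + integral {a..s} u) (u s)) absolutely_integrable_on {a..b}"
proof (rule absolutely_integrable_bounded_measurable_product[OF bilinear_cross2 _ _ _ u])
  have cont: "continuous_on {a..b} (\<lambda>s. c + integral {a..s} u)"
    using set_lebesgue_integral_eq_integral(1)[OF u]
    by (intro continuous_on_add continuous_on_const indefinite_integral_continuous_1)
  show "(\<lambda>s. c + integral {a..s} u) \<in> borel_measurable (lebesgue_on {a..b})"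
    using cont by (rule continuous_imp_measurable_on_sets_lebesgue) simp
  show "bounded ((\<lambda>s. c + integral {a..s} u) ` {a..b})"
    using compact_continuous_image[OF cont] by (simp add: compact_imp_bounded)
qed simp

lemma integrable_swept_area:
  fixes u :: "real \<Rightarrow> complex"
  assumes "u absolutely_integrable_on {a..b}" "t \<le> b"
  shows "(\<lambda>s. cross2 (c + integral {a..s} u) (u s)) integrable_on {a..t}"
proof -
  have "(\<lambda>s. cross2 (c + integral {a..s} u) (u s)) integrable_on {a..b}"
    using absolutely_integrable_swept_area[OF assms(1)] by (rule set_lebesgue_integral_eq_integral(1))
  then show ?thesis by (rule integrable_on_subinterval) (use assms(2) in auto)
qed

lemma integral_swept_area_translate:
  fixes u :: "real \<Rightarrow> complex"
  assumes u: "u absolutely_integrable_on {a..b}"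
  shows "integral {a..b} (\<lambda>s. cross2 (c + integral {a..s} u) (u s)) =
    cross2 c (integral {a..b} u) + integral {a..b} (\<lambda>s. cross2 (integral {a..s} u) (u s))"
proof -
  have ui: "u integrable_on {a..b}" using u by (rule set_lebesgue_integral_eq_integral(1))
  have "(\<lambda>s. cross2 c (u s)) integrable_on {a..b}"
    using integrable_linear[OF ui bounded_linear_cross2] by (simp add: o_def)
  moreover have "integral {a..b} (\<lambda>s. cross2 c (u s)) = cross2 c (integral {a..b} u)"
    using integral_linear[OF ui bounded_linear_cross2] by (simp add: o_def)
  moreover have "(\<lambda>s. cross2 (integral {a..s} u) (u s)) integrable_on {a..b}"
    using integrable_swept_area[OF u order_refl, of 0] by simp
  ultimately show ?thesis by (simp add: integral_add)
qed

lemma hlift_cong_ae: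
  assumes N: "negligible N" and eq: "\<And>s. s \<in> {a..b} - N \<Longrightarrow> u s = v s" and "t \<le> b"
  shows "hlift a u t = hlift a v t"
proof -
  have X: "integral {a..s} u = integral {a..s} v" if "s \<le> t" for s
    using eq that \<open>t \<le> b\<close> by (intro integral_spike[OF N]) auto
  have "integral {a..t} (\<lambda>s. cross2 (integral {a..s} u) (u s)) =
        integral {a..t} (\<lambda>s. cross2 (integral {a..s} v) (v s))"
    using eq X \<open>t \<le> b\<close> by (intro integral_spike[OF N]) auto
  then show ?thesis using X[of t] by (simp add: heis_eq_iff)
qed

text \<open>Left translations preserve horizontal curves, so concatenation of controls is multiplication of end points.\<close>
lemma hlift_concat:
  assumes u: "u absolutely_integrable_on {a..c}" and "a \<le> b" "b \<le> c"
  shows "hlift a u c = hlift a u b \<star> hlift b u c"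
proof -
  have ui: "u integrable_on {a..c}" using u set_lebesgue_integral_eq_integral(1) by blast
  have ubc: "u absolutely_integrable_on {b..c}"
    using \<open>a \<le> b\<close> by (intro absolutely_integrable_on_subinterval[OF u]) auto
  define X where "X = integral {a..b} u"
  have split: "integral {a..s} u = X + integral {b..s} u" if "b \<le> s" "s \<le> c" for s
    using indefinite_integral_diff[OF ui, of b s] that \<open>a \<le> b\<close> by (simp add: X_def algebra_simps)
  let ?A = "\<lambda>s. cross2 (integral {a..s} u) (u s)"
  have "?A integrable_on {a..c}" using integrable_swept_area[OF u, of c 0] by simp
  then have "integral {a..c} ?A = integral {a..b} ?A + integral {b..c} ?A"
    using assms by (intro Henstock_Kurzweil_Integration.integral_combine[symmetric]) auto
  also have "integral {b..c} ?A = integral {b..c} (\<lambda>s. cross2 (X + integral {b..s} u) (u s))"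
    using split by (intro integral_cong) simp
  also note integral_swept_area_translate[OF ubc]
  finally show ?thesis
    using split[of c] \<open>b \<le> c\<close> by (simp add: heis_eq_iff X_def cross2_def field_simps)
qed

lemma has_integral_affine_substitution:
  fixes f :: "real \<Rightarrow> 'a::euclidean_space"
  assumes f: "f integrable_on {a..a + m * t}" and "m > 0"
  shows "((\<lambda>s. m *\<^sub>R f (a + m * s)) has_integral integral {a..a + m * t} f) {0..t}"
proof -
  have "(f has_integral integral {a..a + m * t} f) (cbox a (a + m * t))" using f by auto
  from has_integral_affinity'[OF this \<open>m > 0\<close>, of a]
  have "((\<lambda>s. f (m * s + a)) has_integral integral {a..a + m * t} f /\<^sub>R m) {0..t}"
    using \<open>m > 0\<close> by (simp add: mult.assoc[symmetric])
  from has_integral_cmul[OF this, of m] show ?thesis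
    using \<open>m > 0\<close> by (simp add: add.commute)
qed

lemma affine_reparametrisation:
  fixes u :: "real \<Rightarrow> complex"
  assumes u: "u absolutely_integrable_on {a..a + m * T}" and "m > 0" "T \<ge> 0"
  defines "v \<equiv> \<lambda>s. m *\<^sub>R u (a + m * s)"
  shows "v absolutely_integrable_on {0..T}" "hlift 0 v T = hlift a u (a + m * T)"
    "integral {0..T} (\<lambda>s. norm (v s)) = integral {a..a + m * T} (\<lambda>s. norm (u s))"
proof -
  have ui: "u integrable_on {a..a + m * T}" and nu: "(\<lambda>s. norm (u s)) integrable_on {a..a + m * T}"
    using u by (auto simp: absolutely_integrable_on_def)
  have X: "(v has_integral integral {a..a + m * t} u) {0..t}" if "0 \<le> t" "t \<le> T" for t
    unfolding v_def using that \<open>m > 0\<close>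
    by (intro has_integral_affine_substitution integrable_on_subinterval[OF ui]) auto
  have nv: "((\<lambda>s. norm (v s)) has_integral integral {a..a + m * T} (\<lambda>s. norm (u s))) {0..T}"
    unfolding v_def using has_integral_affine_substitution[OF nu \<open>m > 0\<close>] \<open>m > 0\<close> by simp
  show "v absolutely_integrable_on {0..T}"
    using X[of T] nv \<open>T \<ge> 0\<close> unfolding absolutely_integrable_on_def by blast
  show "integral {0..T} (\<lambda>s. norm (v s)) = integral {a..a + m * T} (\<lambda>s. norm (u s))"
    using nv by (rule integral_unique)
  have "(\<lambda>s. cross2 (integral {a..s} u) (u s)) integrable_on {a..a + m * T}"
    using integrable_swept_area[OF u, of "a + m * T" 0] by simp
  from has_integral_affine_substitution[OF this \<open>m > 0\<close>]
  have "integral {0..T} (\<lambda>s. m *\<^sub>R cross2 (integral {a..a + m * s} u) (u (a + m * s))) =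
      integral {a..a + m * T} (\<lambda>s. cross2 (integral {a..s} u) (u s))"
    by (rule integral_unique)
  moreover have "integral {0..T} (\<lambda>s. cross2 (integral {0..s} v) (v s)) =
      integral {0..T} (\<lambda>s. m *\<^sub>R cross2 (integral {a..a + m * s} u) (u (a + m * s)))"
    using integral_unique[OF X] by (intro integral_cong) (simp add: v_def)
  ultimately show "hlift 0 v T = hlift a u (a + m * T)"
    using integral_unique[OF X[of T]] \<open>T \<ge> 0\<close> by (simp add: heis_eq_iff)
qed

section \<open>The Carnot-Caratheodory norm\<close>

definition reaches :: "real \<Rightarrow> heis \<Rightarrow> bool" where
  "reaches l g \<longleftrightarrow> (\<exists>u. u absolutely_integrable_on {0..1} \<and> hlift 0 u 1 = g \<and>
                       integral {0..1} (\<lambda>t. norm (u t)) = l)"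

lemma reaches_nonneg: "reaches l g \<Longrightarrow> 0 \<le> l"
  unfolding reaches_def absolutely_integrable_on_def by (auto intro: integral_nonneg)

lemma reaches_hlift:
  assumes u: "u absolutely_integrable_on {a..b}" and "a \<le> b"
  shows "reaches (integral {a..b} (\<lambda>t. norm (u t))) (hlift a u b)"
proof (cases "a = b")
  case True
  have "reaches 0 0"
    unfolding reaches_def by (intro exI[of _ "\<lambda>_. 0"]) (simp add: heis_eq_iff)
  moreover have "hlift a u b = 0" using True by (simp add: heis_eq_iff)
  ultimately show ?thesis using True by simp
next
  case False
  then show ?thesis
    using affine_reparametrisation[of a "b - a" 1 u] u \<open>a \<le> b\<close> unfolding reaches_def by auto
qed

lemma reaches_mult:
  assumes "reaches l g" "reaches m h"
  shows "reaches (l + m) (g \<star> h)"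
proof -
  obtain u where u: "u absolutely_integrable_on {0..1}" "hlift 0 u 1 = g" "integral {0..1} (\<lambda>t. norm (u t)) = l"
    using assms(1) by (auto simp: reaches_def)
  obtain v where v: "v absolutely_integrable_on {0..1}" "hlift 0 v 1 = h" "integral {0..1} (\<lambda>t. norm (v t)) = m"
    using assms(2) by (auto simp: reaches_def)
  define w where "w t = (if t < 1 then u t else v (t - 1))" for t
  have uw: "w absolutely_integrable_on {0..1}" "hlift 0 w 1 = g" "integral {0..1} (\<lambda>t. norm (w t)) = l"
  proof -
    have eq: "w t = u t" if "t \<in> {0..1} - {1}" for t using that by (auto simp: w_def)
    show "w absolutely_integrable_on {0..1}"
      by (rule absolutely_integrable_spike[OF u(1), of "{1}"]) (use eq in auto)
    show "hlift 0 w 1 = g"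
      unfolding u(2)[symmetric] by (rule hlift_cong_ae[of "{1}" _ 1]) (use eq in auto)
    show "integral {0..1} (\<lambda>t. norm (w t)) = l"
      unfolding u(3)[symmetric] by (rule integral_spike[of "{1}"]) (use eq in auto)
  qed
  have w1: "w absolutely_integrable_on {1..2}"
  proof -
    have nv: "(v has_integral integral {0..1} v) {0..1}" "((\<lambda>t. norm (v t)) has_integral m) {0..1}"
      using v unfolding absolutely_integrable_on_def by auto
    have "(\<lambda>t. v (t - 1)) integrable_on {1..2}" "(\<lambda>t. norm (v (t - 1))) integrable_on {1..2}"
      using nv has_integral_affinity'[of v _ 0 1 1 "-1"] has_integral_affinity'[of "\<lambda>t. norm (v t)" _ 0 1 1 "-1"]
      by auto
    then have "(\<lambda>t. v (t - 1)) absolutely_integrable_on {1..2}"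
      by (simp add: absolutely_integrable_on_def)
    then show ?thesis
      by (rule absolutely_integrable_spike[of _ _ "{}"]) (auto simp: w_def)
  qed
  have vw: "hlift 1 w 2 = h" "integral {1..2} (\<lambda>t. norm (w t)) = m"
  proof -
    have ww: "w absolutely_integrable_on {1..1 + 1 * 1}" using w1 by simp
    note aff = affine_reparametrisation[OF ww, simplified]
    have eq: "w (1 + t) = v t" if "t \<in> {0..1}" for t using that by (auto simp: w_def)
    have "hlift 0 (\<lambda>t. w (1 + t)) 1 = hlift 0 v 1"
      by (rule hlift_cong_ae[of "{}" _ 1]) (use eq in auto)
    then show "hlift 1 w 2 = h" using aff(2) v by simp
    have "integral {0..1} (\<lambda>t. norm (w (1 + t))) = integral {0..1} (\<lambda>t. norm (v t))"
      using eq by (intro integral_cong) simp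
    then show "integral {1..2} (\<lambda>t. norm (w t)) = m" using aff(3) v by simp
  qed
  have w: "w absolutely_integrable_on {0..2}"
    using uw(1) w1 by (rule absolutely_integrable_on_combine) auto
  have "integral {0..2} (\<lambda>t. norm (w t)) = l + m"
    using Henstock_Kurzweil_Integration.integral_combine[of 0 1 2 "\<lambda>t. norm (w t)"] w uw(3) vw(2)
    by (simp add: absolutely_integrable_on_def)
  moreover have "hlift 0 w 2 = g \<star> h"
    using hlift_concat[OF w, of 1] uw vw by simp
  ultimately show ?thesis using reaches_hlift[OF w] by simp
qed

definition hplane :: "complex \<Rightarrow> heis" where
  "hplane w = vector [Re w, Im w, 0]"

lemma hplane_nth [simp]: "hplane w $ 1 = Re w" "hplane w $ 2 = Im w" "hplane w $ 3 = 0"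
  by (simp_all add: hplane_def)

lemma reaches_hplane: "reaches (norm w) (hplane w)"
  unfolding reaches_def
proof (intro exI[of _ "\<lambda>_. w"] conjI)
  have "cross2 (integral {0..s} (\<lambda>_. w)) w = 0" for s :: real by simp
  then show "hlift 0 (\<lambda>_. w) 1 = hplane w" by (simp add: heis_eq_iff)
qed (auto intro: absolutely_integrable_continuous_real)

text \<open>The commutator of two orthogonal horizontal segments of length \<open>sqrt \<bar>z\<bar>\<close>: the planar curve is the
  boundary of a square of area \<open>\<bar>z\<bar>\<close>.\<close>
lemma reaches_vertical: "reaches (4 * sqrt \<bar>z\<bar>) (z *\<^sub>R hZ)"
proof -
  define a where "a = sqrt \<bar>z\<bar>"
  define b where "b = sgn z * a"
  have "\<bar>b\<bar> = a" by (auto simp: a_def b_def sgn_if)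
  have "a * b = z" by (auto simp: a_def b_def sgn_if)
  have "reaches (norm (complex_of_real a) + norm (\<i> * b) + norm (- complex_of_real a) + norm (- (\<i> * b)))
     (hplane (complex_of_real a) \<star> hplane (\<i> * b) \<star> hplane (- complex_of_real a) \<star> hplane (- (\<i> * b)))"
    by (intro reaches_mult reaches_hplane)
  moreover have "hplane (complex_of_real a) \<star> hplane (\<i> * b) \<star> hplane (- complex_of_real a) \<star> hplane (- (\<i> * b)) = z *\<^sub>R hZ"
    using \<open>a * b = z\<close> by (simp add: heis_eq_iff hZ_def axis_def field_simps)
  moreover have "a \<ge> 0" by (simp add: a_def)
  ultimately show ?thesis using \<open>\<bar>b\<bar> = a\<close> by (simp add: norm_mult a_def)
qed

lemma reaches_exists: "reaches (norm (Complex (g $ 1) (g $ 2)) + 4 * sqrt \<bar>g $ 3\<bar>) g"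
proof -
  have "hplane (Complex (g $ 1) (g $ 2)) \<star> (g $ 3 *\<^sub>R hZ) = g"
    by (simp add: heis_eq_iff hZ_def axis_def)
  then show ?thesis
    using reaches_mult[OF reaches_hplane[of "Complex (g $ 1) (g $ 2)"] reaches_vertical[of "g $ 3"]] by simp
qed

definition dilation :: "real \<Rightarrow> heis \<Rightarrow> heis" where
  "dilation r g = vector [r * g $ 1, r * g $ 2, r\<^sup>2 * g $ 3]"

lemma dilation_nth [simp]:
  "dilation r g $ 1 = r * g $ 1" "dilation r g $ 2 = r * g $ 2" "dilation r g $ 3 = r\<^sup>2 * g $ 3"
  by (simp_all add: dilation_def)

lemma reaches_dilation:
  assumes "reaches l g" "r \<ge> 0"
  shows "reaches (r * l) (dilation r g)"
proof -
  obtain u where u: "u absolutely_integrable_on {0..1}" "hlift 0 u 1 = g" "integral {0..1} (\<lambda>t. norm (u t)) = l"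
    using assms(1) by (auto simp: reaches_def)
  show ?thesis
    unfolding reaches_def
  proof (intro exI[of _ "\<lambda>t. r *\<^sub>R u t"] conjI)
    show "(\<lambda>t. r *\<^sub>R u t) absolutely_integrable_on {0..1}"
      using u(1) by (rule absolutely_integrable_scaleR_left)
    show "integral {0..1} (\<lambda>t. norm (r *\<^sub>R u t)) = r * l"
      using u(3) \<open>r \<ge> 0\<close> by simp
    have "integral {0..1} (\<lambda>s. r * (r * cross2 (integral {0..s} u) (u s))) =
        r\<^sup>2 * integral {0..1} (\<lambda>s. cross2 (integral {0..s} u) (u s))"
      by (simp add: power2_eq_square)
    then show "hlift 0 (\<lambda>t. r *\<^sub>R u t) 1 = dilation r g"
      unfolding u(2)[symmetric] by (simp add: heis_eq_iff)
  qed
qed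

text \<open>The sub-Riemannian distance to the identity; see \<open>sr_dist_eq_cc_norm\<close>.\<close>
definition cc_norm :: "heis \<Rightarrow> real" where
  "cc_norm g = Inf {l. reaches l g}"

lemma cc_norm_nonempty: "{l. reaches l g} \<noteq> {}"
  using reaches_exists by blast

lemma cc_norm_bdd: "bdd_below {l. reaches l g}"
  by (rule bdd_belowI[of _ 0]) (auto dest: reaches_nonneg)

lemma cc_norm_le: "reaches l g \<Longrightarrow> cc_norm g \<le> l"
  unfolding cc_norm_def by (intro cInf_lower cc_norm_bdd) simp

lemma cc_norm_less_iff: "cc_norm g < r \<longleftrightarrow> (\<exists>l<r. reaches l g)"
  unfolding cc_norm_def using cInf_less_iff[OF cc_norm_nonempty cc_norm_bdd] by auto

lemma cc_norm_mult: "cc_norm (g \<star> h) \<le> cc_norm g + cc_norm h"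
proof (rule field_le_epsilon)
  fix e :: real assume "e > 0"
  then obtain l m where "l < cc_norm g + e / 2" "reaches l g" "m < cc_norm h + e / 2" "reaches m h"
    using cc_norm_less_iff[of g "cc_norm g + e / 2"] cc_norm_less_iff[of h "cc_norm h + e / 2"] by auto
  then show "cc_norm (g \<star> h) \<le> cc_norm g + cc_norm h + e"
    using cc_norm_le[OF reaches_mult, of l g m h] by simp
qed

lemma cc_norm_dilation_less:
  assumes "r > 0"
  shows "cc_norm (dilation r g) < r * s \<longleftrightarrow> cc_norm g < s"
proof
  assume "cc_norm g < s"
  then obtain l where "l < s" "reaches l g" by (auto simp: cc_norm_less_iff)
  then have "r * l < r * s" "reaches (r * l) (dilation r g)"
    using reaches_dilation[of l g r] \<open>r > 0\<close> by auto
  then show "cc_norm (dilation r g) < r * s" unfolding cc_norm_less_iff by blast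
next
  assume "cc_norm (dilation r g) < r * s"
  then obtain l where l: "l < r * s" "reaches l (dilation r g)" by (auto simp: cc_norm_less_iff)
  have "dilation (1 / r) (dilation r g) = g"
    using \<open>r > 0\<close> by (simp add: heis_eq_iff power2_eq_square)
  then have "reaches (l / r) g" using reaches_dilation[OF l(2), of "1 / r"] \<open>r > 0\<close> by simp
  moreover have "l / r < s" using l \<open>r > 0\<close> by (simp add: field_simps)
  ultimately show "cc_norm g < s" by (auto simp: cc_norm_less_iff)
qed

section \<open>Trading height for length\<close>

lemma cc_norm_hlift_le:
  assumes "u absolutely_integrable_on {a..b}" "a \<le> b"
  shows "cc_norm (hlift a u b) \<le> integral {a..b} (\<lambda>t. norm (u t))"
  using cc_norm_le reaches_hlift[OF assms] by blast

lemma swept_area_le: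
  fixes u :: "real \<Rightarrow> complex"
  assumes u: "u absolutely_integrable_on {a..b}"
    and B: "\<And>s. s \<in> {a..b} \<Longrightarrow> norm (integral {a..s} u) \<le> B"
  shows "\<bar>integral {a..b} (\<lambda>s. cross2 (integral {a..s} u) (u s))\<bar> \<le> B * integral {a..b} (\<lambda>s. norm (u s))"
proof -
  have nu: "(\<lambda>s. norm (u s)) integrable_on {a..b}" using u by (simp add: absolutely_integrable_on_def)
  have "norm (integral {a..b} (\<lambda>s. cross2 (integral {a..s} u) (u s))) \<le> integral {a..b} (\<lambda>s. B * norm (u s))"
  proof (rule integral_norm_bound_integral)
    show "(\<lambda>s. cross2 (integral {a..s} u) (u s)) integrable_on {a..b}"
      using integrable_swept_area[OF u order_refl, of 0] by simp
    show "(\<lambda>s. B * norm (u s)) integrable_on {a..b}"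
      using integrable_on_mult_right[OF nu] by simp
    fix s assume "s \<in> {a..b}"
    then have "norm (integral {a..s} u) * norm (u s) \<le> B * norm (u s)"
      by (intro mult_right_mono B) auto
    with abs_cross2_le[of "integral {a..s} u" "u s"]
    show "norm (cross2 (integral {a..s} u) (u s)) \<le> B * norm (u s)" by simp
  qed
  then show ?thesis by simp
qed

text \<open>If the planar curve has two points at distance at least \<open>2\<close>, the part between them is conjugated by a horizontal
  element \<open>w\<close> with \<open>2 * norm w \<le> \<bar>A\<bar>\<close>, which changes the end point by the central factor \<open>A *\<^sub>R hZ\<close>.  Otherwise the
  swept area is small, so that \<open>\<bar>A\<bar>\<close> and the length together bound the height of \<open>g\<close>, and the bound of
  \<open>reaches_exists\<close> is good enough.\<close>
theorem cc_norm_le_length_plus_height: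
  assumes u: "u absolutely_integrable_on {0..1}"
    and g: "hlift 0 u 1 \<star> (A *\<^sub>R hZ) = g"
    and far: "cc_norm g \<ge> 20"
  shows "cc_norm g \<le> integral {0..1} (\<lambda>t. norm (u t)) + \<bar>A\<bar>"
proof (cases "\<exists>s t. 0 \<le> s \<and> s \<le> t \<and> t \<le> 1 \<and> 2 \<le> norm (integral {s..t} u)")
  case True
  then obtain s t where st: "0 \<le> s" "s \<le> t" "t \<le> 1" and z2: "2 \<le> norm (integral {s..t} u)"
    by blast
  define z where "z = integral {s..t} u"
  \<comment> \<open>orthogonal to \<open>z\<close>, and the bracket of \<open>w\<close> and \<open>z\<close> is \<open>A\<close>\<close>
  define w where "w = (A / (norm z)\<^sup>2) *\<^sub>R (- \<i> * z)"
  have "z \<noteq> 0" using z2 by (auto simp: z_def)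
  have "cross2 (- \<i> * z) z = (norm z)\<^sup>2"
    unfolding cmod_power2 by (simp add: cross2_def power2_eq_square)
  then have "cross2 w z = A"
    using \<open>z \<noteq> 0\<close> unfolding w_def cross2_simps by simp
  have "2 * norm w = \<bar>A\<bar> * (2 / norm z)"
    using \<open>z \<noteq> 0\<close> by (simp add: w_def norm_mult power2_eq_square)
  also have "\<dots> \<le> \<bar>A\<bar> * 1"
    using z2 by (intro mult_left_mono) (auto simp: z_def divide_le_eq_1)
  finally have w: "2 * norm w \<le> \<bar>A\<bar>" by simp
  have u0t: "u absolutely_integrable_on {0..t}" and ust: "u absolutely_integrable_on {s..t}"
      and ut1: "u absolutely_integrable_on {t..1}" and u0s: "u absolutely_integrable_on {0..s}"
    using st by (auto intro!: absolutely_integrable_on_subinterval[OF u])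
  let ?g1 = "hlift 0 u s" and ?g2 = "hlift s u t" and ?g3 = "hlift t u 1"
  \<comment> \<open>conjugating the middle part by \<open>w\<close> is the translation of the planar curve between \<open>s\<close> and \<open>t\<close>\<close>
  have "hlift 0 u 1 = ?g1 \<star> ?g2 \<star> ?g3"
    using hlift_concat[OF u, of t] hlift_concat[OF u0t, of s] st by simp
  then have "g = ?g1 \<star> ?g2 \<star> ?g3 \<star> (A *\<^sub>R hZ)" using g by simp
  also have "\<dots> = ?g1 \<star> hplane w \<star> ?g2 \<star> hplane (- w) \<star> ?g3"
    using \<open>cross2 w z = A\<close> by (simp add: heis_eq_iff hZ_def axis_def cross2_def z_def field_simps)
  also have "cc_norm \<dots> \<le> cc_norm ?g1 + cc_norm (hplane w) + cc_norm ?g2 + cc_norm (hplane (- w)) + cc_norm ?g3"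
    by (intro order.trans[OF cc_norm_mult] add_mono order_refl)
  also have "\<dots> \<le> integral {0..s} (\<lambda>t. norm (u t)) + norm w + integral {s..t} (\<lambda>t. norm (u t)) + norm w +
      integral {t..1} (\<lambda>t. norm (u t))"
    using cc_norm_le[OF reaches_hplane[of w]] cc_norm_le[OF reaches_hplane[of "- w"]]
      cc_norm_hlift_le[OF u0s] cc_norm_hlift_le[OF ust] cc_norm_hlift_le[OF ut1] st by simp
  also have "\<dots> = integral {0..1} (\<lambda>t. norm (u t)) + 2 * norm w"
    using Henstock_Kurzweil_Integration.integral_combine[of 0 s t "\<lambda>t. norm (u t)"]
      Henstock_Kurzweil_Integration.integral_combine[of 0 t 1 "\<lambda>t. norm (u t)"] st u u0t
    by (simp add: absolutely_integrable_on_def)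
  finally show ?thesis using w by simp
next
  case False
  define l where "l = integral {0..1} (\<lambda>t. norm (u t))"
  have small: "norm (integral {0..s} u) \<le> 2" if "s \<in> {0..1}" for s
  proof -
    have "\<not> 2 \<le> norm (integral {0..s} u)" using False that by auto
    then show ?thesis by simp
  qed
  have "\<bar>integral {0..1} (\<lambda>s. cross2 (integral {0..s} u) (u s))\<bar> \<le> 2 * l"
    unfolding l_def by (rule swept_area_le[OF u small])
  moreover have "g $ 3 = integral {0..1} (\<lambda>s. cross2 (integral {0..s} u) (u s)) / 2 + A"
    and gh: "Complex (g $ 1) (g $ 2) = integral {0..1} u"
    using g[symmetric] by (simp_all add: hZ_def axis_def complex_eq_iff)
  ultimately have g3: "\<bar>g $ 3\<bar> \<le> l + \<bar>A\<bar>" by linarith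
  define x where "x = sqrt \<bar>g $ 3\<bar>"
  have "cc_norm g \<le> 2 + 4 * x"
    using cc_norm_le[OF reaches_exists[of g]] small[of 1] gh by (simp add: x_def)
  with far have "9 / 2 \<le> x" by simp
  \<comment> \<open>\<open>9 / 2\<close> is just above the positive root of \<open>x\<^sup>2 - 4 x - 2\<close>\<close>
  then have "0 \<le> (x - 9 / 2) * (x + 1 / 2)" by simp
  then have "2 + 4 * x \<le> x\<^sup>2" using \<open>9 / 2 \<le> x\<close> by (simp add: power2_eq_square algebra_simps)
  also have "x\<^sup>2 = \<bar>g $ 3\<bar>" by (simp add: x_def)
  finally show ?thesis using \<open>cc_norm g \<le> 2 + 4 * x\<close> g3 by (simp add: l_def)
qed

section \<open>The two distances\<close>

lemma inv_dL_nth [simp]: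
  "inv (dL p) v $ 1 = v $ 1" "inv (dL p) v $ 2 = v $ 2"
  "inv (dL p) v $ 3 = v $ 3 - (p $ 1 * v $ 2 - p $ 2 * v $ 1) / 2"
  by (simp_all add: inv_dL_eq hbracket_def hZ_def axis_def)

lemma sqrt_rho_eq: "sqrt (rho p v v) = norm (Complex (v $ 1) (v $ 2))"
  by (simp add: rho_def rho_e_def cmod_def power2_eq_square)

lemma heis_norm_eq: "heis_norm v = norm (Complex (v $ 1) (v $ 2)) + \<bar>v $ 3\<bar>"
  by (simp add: heis_norm_def sqrt_rho_eq horizontal_part_def hX_def hY_def axis_def)

lemma mem_Delta_iff: "v \<in> Delta p \<longleftrightarrow> inv (dL p) v $ 3 = 0"
proof -
  have span: "span {hX, hY} = {w. w $ 3 = 0}"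
  proof -
    have "w $ 3 = 0" if "w \<in> span {hX, hY}" for w
      using that by (auto simp: span_insert span_empty hX_def hY_def axis_def vector_sub_project_orthogonal
          algebra_simps)
    moreover have "w \<in> span {hX, hY}" if "w $ 3 = 0" for w :: heis
    proof -
      have "w = w $ 1 *\<^sub>R hX + w $ 2 *\<^sub>R hY"
        using that by (simp add: heis_eq_iff hX_def hY_def axis_def)
      then show ?thesis by (metis insertI1 insertI2 span_add span_base span_scale)
    qed
    ultimately show ?thesis by blast
  qed
  have inv: "dL p (inv (dL p) v) = v" "inv (dL p) (dL p w) = w" for w
    by (simp_all add: heis_eq_iff dL_eq hbracket_def hZ_def axis_def)
  show ?thesis
    unfolding Delta_def span using inv by (metis (mono_tags, lifting) imageE imageI mem_Collect_eq)
qed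

lemma AE_unit_interval_iff:
  "(AE t in lebesgue_on {0..1::real}. P t) \<longleftrightarrow> (\<exists>N. negligible N \<and> (\<forall>t\<in>{0..1} - N. P t))"
proof
  assume "AE t in lebesgue_on {0..1::real}. P t"
  then have "AE t in lebesgue. t \<in> {0..1} \<longrightarrow> P t"
    by (simp add: AE_restrict_space_iff)
  then obtain N where "N \<in> null_sets lebesgue" "{t. \<not> (t \<in> {0..1} \<longrightarrow> P t)} \<subseteq> N"
    by (auto simp: eventually_ae_filter)
  then show "\<exists>N. negligible N \<and> (\<forall>t\<in>{0..1} - N. P t)"
    by (intro exI[of _ N]) (auto simp: negligible_iff_null_sets)
next
  assume "\<exists>N. negligible N \<and> (\<forall>t\<in>{0..1} - N. P t)"
  then obtain N where "N \<in> null_sets lebesgue" "\<And>t. t \<in> {0..1} - N \<Longrightarrow> P t"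
    by (auto simp: negligible_iff_null_sets)
  then have "AE t in lebesgue. t \<in> {0..1} \<longrightarrow> P t"
    by (intro AE_I'[of N]) auto
  then show "AE t in lebesgue_on {0..1::real}. P t"
    by (simp add: AE_restrict_space_iff)
qed

text \<open>The horizontal and the vertical part of the velocity in the left-invariant frame; the differential of a left
  translation does not change the first two coordinates of a vector.\<close>
definition hcontrol :: "(real \<Rightarrow> heis) \<Rightarrow> real \<Rightarrow> complex" where
  "hcontrol \<gamma> t = Complex (velocity \<gamma> t $ 1) (velocity \<gamma> t $ 2)"

definition vspeed :: "(real \<Rightarrow> heis) \<Rightarrow> real \<Rightarrow> real" where
  "vspeed \<gamma> t = inv (dL (\<gamma> t)) (velocity \<gamma> t) $ 3"

lemma heis_norm_velocity:
  "heis_norm (inv (dL (\<gamma> t)) (velocity \<gamma> t)) = norm (hcontrol \<gamma> t) + \<bar>vspeed \<gamma> t\<bar>"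
  by (simp add: heis_norm_eq hcontrol_def vspeed_def)

lemma sqrt_rho_velocity: "sqrt (rho p (velocity \<gamma> t) (velocity \<gamma> t)) = norm (hcontrol \<gamma> t)"
  by (simp add: sqrt_rho_eq hcontrol_def)

lemma absolutely_integrable_nth:
  fixes f :: "real \<Rightarrow> real^3"
  assumes "f absolutely_integrable_on S"
  shows "(\<lambda>t. f t $ i) absolutely_integrable_on S"
  using absolutely_integrable_component[OF assms, where b = "axis i 1"] by (simp add: inner_axis)

lemma absolutely_integrable_Complex:
  assumes "f absolutely_integrable_on S" "g absolutely_integrable_on S"
  shows "(\<lambda>t. Complex (f t) (g t)) absolutely_integrable_on S"
proof (rule absolutely_integrable_componentwise)
  fix b :: complex assume "b \<in> Basis"
  then consider "b = 1" | "b = \<i>" by (auto simp: Basis_complex_def)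
  then show "(\<lambda>t. Complex (f t) (g t) \<bullet> b) absolutely_integrable_on S"
    using assms by cases (simp_all add: inner_complex_def)
qed

text \<open>The end point of a curve in terms of its control and its vertical speed: as vertical elements are central, all the
  vertical displacement can be moved to the end of the curve.\<close>
lemma ac_curve_decomposition:
  assumes "ac_curve p q \<gamma>"
  shows "hcontrol \<gamma> absolutely_integrable_on {0..1}" (is ?u)
    and "vspeed \<gamma> absolutely_integrable_on {0..1}" (is ?l)
    and "hlift 0 (hcontrol \<gamma>) 1 \<star> (integral {0..1} (vspeed \<gamma>) *\<^sub>R hZ) = (- p) \<star> q" (is ?e)
proof -
  have ac: "abs_continuous_on 0 1 \<gamma>" and ends: "\<gamma> 0 = p" "\<gamma> 1 = q"
    using assms by (auto simp: ac_curve_def)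
  obtain N where N: "negligible N" "\<And>x. x \<in> {0<..<1} - N \<Longrightarrow> \<gamma> differentiable (at x)"
    using abs_continuous_on_differentiable_ae[OF ac] by auto
  define M where "M = N \<union> {0, 1}"
  have M: "negligible M" using N by (simp add: M_def)
  have deriv: "(\<gamma> has_vector_derivative velocity \<gamma> t) (at t within {0..1})" if "t \<in> {0..1} - M" for t
  proof -
    have "t \<in> {0<..<1} - N" using that by (auto simp: M_def)
    then have "\<gamma> differentiable (at t within {0..1})"
      using N(2) differentiable_at_withinI by blast
    then show ?thesis unfolding velocity_def by (simp add: vector_derivative_works)
  qed
  have vint: "velocity \<gamma> absolutely_integrable_on {0..1}"
    using abs_continuous_on_absolutely_integrable_derivative[OF ac _ M deriv] by simp
  have vsub: "velocity \<gamma> integrable_on {0..t}" if "t \<in> {0..1}" for t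
    using that set_lebesgue_integral_eq_integral(1)[OF vint] by (auto intro: integrable_on_subinterval)
  have ftc: "(velocity \<gamma> has_integral (\<gamma> t - p)) {0..t}" if t: "t \<in> {0..1}" for t
    unfolding ends(1)[symmetric]
  proof (rule abs_continuous_on_has_integral_derivative[OF _ _ M])
    show "abs_continuous_on 0 t \<gamma>" using abs_continuous_on_subinterval[OF ac] t by simp
    show "(\<gamma> has_vector_derivative velocity \<gamma> x) (at x within {0..t})" if "x \<in> {0..t} - M" for x
      using that t by (intro has_vector_derivative_within_subset[OF deriv]) auto
  qed (use t in auto)
  have comp: "((\<lambda>s. velocity \<gamma> s $ i) has_integral (\<gamma> t $ i - p $ i)) {0..t}" if "t \<in> {0..1}" for t i
    using has_integral_linear[OF ftc[OF that] bounded_linear_vec_nth[of i]] by (simp add: o_def)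
  show ?u
    unfolding hcontrol_def by (intro absolutely_integrable_Complex absolutely_integrable_nth vint)
  have X: "integral {0..t} (hcontrol \<gamma>) = Complex (\<gamma> t $ 1 - p $ 1) (\<gamma> t $ 2 - p $ 2)" if t: "t \<in> {0..1}" for t
  proof -
    have hi: "hcontrol \<gamma> integrable_on {0..t}"
      using set_lebesgue_integral_eq_integral(1)[OF \<open>?u\<close>] t by (auto intro: integrable_on_subinterval)
    have "Re (integral {0..t} (hcontrol \<gamma>)) = integral {0..t} (\<lambda>s. Re (hcontrol \<gamma> s))"
      "Im (integral {0..t} (hcontrol \<gamma>)) = integral {0..t} (\<lambda>s. Im (hcontrol \<gamma> s))"
      using integral_linear[OF hi bounded_linear_Re] integral_linear[OF hi bounded_linear_Im] by (simp_all add: o_def)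
    then show ?thesis
      using integral_unique[OF comp[OF t, of 1]] integral_unique[OF comp[OF t, of 2]]
      by (simp add: complex_eq_iff hcontrol_def)
  qed
  define A where "A s = cross2 (Complex (p $ 1) (p $ 2) + integral {0..s} (hcontrol \<gamma>)) (hcontrol \<gamma> s)" for s
  have Aint: "A absolutely_integrable_on {0..1}"
    unfolding A_def by (rule absolutely_integrable_swept_area[OF \<open>?u\<close>])
  have vs: "vspeed \<gamma> s = velocity \<gamma> s $ 3 - (1 / 2) *\<^sub>R A s" if "s \<in> {0..1}" for s
    using X[OF that] by (simp add: vspeed_def A_def cross2_def hcontrol_def)
  have "(\<lambda>s. velocity \<gamma> s $ 3 - (1 / 2) *\<^sub>R A s) absolutely_integrable_on {0..1}"
    by (intro set_integral_diff(1) absolutely_integrable_nth vint absolutely_integrable_scaleR_left Aint)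
  then show ?l
    by (rule absolutely_integrable_spike[of _ _ "{}"]) (use vs in auto)
  have "integral {0..1} (vspeed \<gamma>) = integral {0..1} (\<lambda>s. velocity \<gamma> s $ 3 - (1 / 2) *\<^sub>R A s)"
    using vs by (intro integral_cong) auto
  also have "\<dots> = integral {0..1} (\<lambda>s. velocity \<gamma> s $ 3) - integral {0..1} (\<lambda>s. (1 / 2) *\<^sub>R A s)"
    using comp[of 1 3] set_lebesgue_integral_eq_integral(1)[OF Aint]
    by (intro integral_diff) (auto intro: integrable_cmul)
  also have "\<dots> = q $ 3 - p $ 3 - integral {0..1} A / 2"
    using integral_unique[OF comp[of 1 3]] ends by simp
  also have "integral {0..1} A = cross2 (Complex (p $ 1) (p $ 2)) (integral {0..1} (hcontrol \<gamma>)) +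
      integral {0..1} (\<lambda>s. cross2 (integral {0..s} (hcontrol \<gamma>)) (hcontrol \<gamma> s))"
    unfolding A_def by (rule integral_swept_area_translate[OF \<open>?u\<close>])
  finally show ?e
    using X[of 1] ends by (simp add: heis_eq_iff hZ_def axis_def cross2_def field_simps)
qed

text \<open>The converse of the decomposition for vanishing vertical speed.  The curve is written as an indefinite integral in
  \<open>real^3\<close>, which gives absolute continuity and the derivative almost everywhere at one stroke.\<close>
lemma horizontal_curve_of_control:
  assumes u: "u absolutely_integrable_on {0..1}"
  obtains \<gamma> where "ac_curve p (p \<star> hlift 0 u 1) \<gamma>" "horizontal \<gamma>"
    "integral {0..1} (\<lambda>t. norm (hcontrol \<gamma> t)) = integral {0..1} (\<lambda>t. norm (u t))"
proof -
  define P where "P = Complex (p $ 1) (p $ 2)"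
  define A where "A s = cross2 (P + integral {0..s} u) (u s)" for s
  define V :: "real \<Rightarrow> heis" where "V s = vector [Re (u s), Im (u s), A s / 2]" for s
  define \<gamma> where "\<gamma> t = p + integral {0..t} V" for t
  have V_nth: "V s $ 1 = Re (u s)" "V s $ 2 = Im (u s)" "V s $ 3 = A s / 2" for s
    by (simp_all add: V_def)
  have Aint: "A absolutely_integrable_on {0..1}"
    unfolding A_def by (rule absolutely_integrable_swept_area[OF u])
  have ReIm: "(\<lambda>s. Re (u s)) absolutely_integrable_on {0..1}" "(\<lambda>s. Im (u s)) absolutely_integrable_on {0..1}"
    using absolutely_integrable_linear[OF u bounded_linear_Re] absolutely_integrable_linear[OF u bounded_linear_Im]
    by (simp_all add: o_def)
  have A2: "(\<lambda>s. A s / 2) absolutely_integrable_on {0..1}"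
    using absolutely_integrable_scaleR_left[OF Aint, of "1 / 2"] by simp
  have Vint: "V absolutely_integrable_on {0..1}"
  proof (rule absolutely_integrable_componentwise)
    fix b :: heis assume "b \<in> Basis"
    then obtain i where "b = axis i 1" by (auto simp: Basis_vec_def)
    then show "(\<lambda>s. V s \<bullet> b) absolutely_integrable_on {0..1}"
      using ReIm A2 exhaust_3[of i] by (auto simp: V_nth inner_axis)
  qed
  have nth: "integral {0..t} V $ i = integral {0..t} (\<lambda>s. V s $ i)" if "t \<in> {0..1}" for t i
  proof -
    have "V integrable_on {0..t}"
      using that set_lebesgue_integral_eq_integral(1)[OF Vint] by (auto intro: integrable_on_subinterval)
    from integral_linear[OF this bounded_linear_vec_nth[of i]] show ?thesis by (simp add: o_def)
  qed
  have \<gamma>12: "\<gamma> t $ 1 = p $ 1 + Re (integral {0..t} u)" "\<gamma> t $ 2 = p $ 2 + Im (integral {0..t} u)"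
    if t: "t \<in> {0..1}" for t
  proof -
    have ui: "u integrable_on {0..t}"
      using that set_lebesgue_integral_eq_integral(1)[OF u] by (auto intro: integrable_on_subinterval)
    show "\<gamma> t $ 1 = p $ 1 + Re (integral {0..t} u)" "\<gamma> t $ 2 = p $ 2 + Im (integral {0..t} u)"
      using integral_linear[OF ui bounded_linear_Re] integral_linear[OF ui bounded_linear_Im]
      by (simp_all add: \<gamma>_def nth[OF t] V_nth o_def)
  qed
  have "integral {0..1} A = cross2 P (integral {0..1} u) +
      integral {0..1} (\<lambda>s. cross2 (integral {0..s} u) (u s))"
    unfolding A_def by (rule integral_swept_area_translate[OF u])
  then have \<gamma>1: "\<gamma> 1 = p \<star> hlift 0 u 1"
    using \<gamma>12[of 1] by (simp add: heis_eq_iff \<gamma>_def nth V_nth P_def cross2_def field_simps)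
  obtain N where N: "negligible N" "\<And>t. t \<in> {0<..<1} - N \<Longrightarrow> (\<gamma> has_vector_derivative V t) (at t)"
    using indefinite_integral_has_derivative_ae[OF Vint zero_le_one, of p] unfolding \<gamma>_def[abs_def] by blast
  define M where "M = N \<union> {0, 1}"
  have M: "negligible M" using N by (simp add: M_def)
  have deriv: "\<gamma> differentiable (at t within {0..1})" "velocity \<gamma> t = V t" if "t \<in> {0..1} - M" for t
  proof -
    have "t \<in> {0<..<1} - N" using that by (auto simp: M_def)
    from has_vector_derivative_at_within[OF N(2)[OF this]]
    have d: "(\<gamma> has_vector_derivative V t) (at t within {0..1})" .
    show "\<gamma> differentiable (at t within {0..1})" using d by (rule differentiableI_vector)
    show "velocity \<gamma> t = V t"
      unfolding velocity_def using vector_derivative_within_cbox[of 0 1 t \<gamma> "V t"] d that by simp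
  qed
  show ?thesis
  proof
    show "ac_curve p (p \<star> hlift 0 u 1) \<gamma>"
      unfolding ac_curve_def
    proof (intro conjI)
      show "abs_continuous_on 0 1 \<gamma>"
        unfolding \<gamma>_def[abs_def] by (rule abs_continuous_on_indefinite_integral[OF Vint])
      show "\<gamma> 0 = p" by (simp add: \<gamma>_def)
    qed (rule \<gamma>1)
    show "horizontal \<gamma>"
      unfolding horizontal_def AE_unit_interval_iff
    proof (intro exI[of _ M] conjI M ballI)
      fix t assume t: "t \<in> {0..1} - M"
      then show "\<gamma> differentiable (at t within {0..1})" by (rule deriv)
      have "t \<in> {0..1}" using t by simp
      then show "velocity \<gamma> t \<in> Delta (\<gamma> t)"
        unfolding mem_Delta_iff deriv(2)[OF t] by (simp add: V_nth \<gamma>12 A_def P_def cross2_def)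
    qed
    show "integral {0..1} (\<lambda>t. norm (hcontrol \<gamma> t)) = integral {0..1} (\<lambda>t. norm (u t))"
      using deriv(2) by (intro integral_spike[OF M]) (simp add: hcontrol_def V_nth)
  qed
qed

lemma horizontal_vspeed:
  assumes "horizontal \<gamma>"
  obtains N where "negligible N" "\<And>t. t \<in> {0..1} - N \<Longrightarrow> vspeed \<gamma> t = 0"
  using assms unfolding horizontal_def AE_unit_interval_iff vspeed_def mem_Delta_iff by blast

definition horizontal_lengths :: "heis \<Rightarrow> heis \<Rightarrow> real set" where
  "horizontal_lengths p q =
    {integral {0..1} (\<lambda>t. norm (hcontrol \<gamma> t)) | \<gamma>. ac_curve p q \<gamma> \<and> horizontal \<gamma>}"

lemma horizontal_lengths_eq: "horizontal_lengths p q = {l. reaches l (- p \<star> q)}"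
proof (intro equalityI subsetI)
  fix l assume "l \<in> horizontal_lengths p q"
  then obtain \<gamma> where \<gamma>: "ac_curve p q \<gamma>" "horizontal \<gamma>" and l: "l = integral {0..1} (\<lambda>t. norm (hcontrol \<gamma> t))"
    by (auto simp: horizontal_lengths_def)
  obtain N where N: "negligible N" "\<And>t. t \<in> {0..1} - N \<Longrightarrow> vspeed \<gamma> t = 0"
    using horizontal_vspeed[OF \<gamma>(2)] by blast
  have "integral {0..1} (vspeed \<gamma>) = integral {0..1} (\<lambda>t::real. 0)"
    using N(2) by (intro integral_spike[OF N(1)]) simp
  then have "hlift 0 (hcontrol \<gamma>) 1 = - p \<star> q"
    using ac_curve_decomposition(3)[OF \<gamma>(1)] by (simp add: hmult_unit)
  then show "l \<in> {l. reaches l (- p \<star> q)}"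
    using ac_curve_decomposition(1)[OF \<gamma>(1)] l unfolding reaches_def by blast
next
  fix l assume "l \<in> {l. reaches l (- p \<star> q)}"
  then obtain u where u: "u absolutely_integrable_on {0..1}" "hlift 0 u 1 = - p \<star> q"
      "integral {0..1} (\<lambda>t. norm (u t)) = l"
    by (auto simp: reaches_def)
  have "p \<star> hlift 0 u 1 = q"
    unfolding u(2) by (simp add: hmult_assoc[symmetric] hmult_inverse hmult_unit)
  with horizontal_curve_of_control[OF u(1), of p] obtain \<gamma> where
    "ac_curve p q \<gamma>" "horizontal \<gamma>" "integral {0..1} (\<lambda>t. norm (hcontrol \<gamma> t)) = l"
    unfolding u(3) by auto
  then show "l \<in> horizontal_lengths p q" unfolding horizontal_lengths_def by blast
qed

theorem sr_dist_eq_cc_norm: "sr_dist p q = cc_norm (- p \<star> q)"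
  unfolding sr_dist_def cc_norm_def sqrt_rho_velocity horizontal_lengths_eq[symmetric]
  by (simp add: horizontal_lengths_def)

lemma finsler_dist_bounds:
  shows finsler_dist_le_sr_dist: "finsler_dist heis_norm p q \<le> sr_dist p q"
    and sr_dist_le_finsler_dist: "sr_dist p q \<ge> 20 \<Longrightarrow> sr_dist p q \<le> finsler_dist heis_norm p q"
proof -
  let ?F = "{integral {0..1} (\<lambda>t. norm (hcontrol \<gamma> t) + \<bar>vspeed \<gamma> t\<bar>) | \<gamma>. ac_curve p q \<gamma>}"
  have F: "finsler_dist heis_norm p q = Inf ?F"
    by (simp add: finsler_dist_def heis_norm_velocity)
  have S: "sr_dist p q = Inf (horizontal_lengths p q)"
    by (simp add: sr_dist_eq_cc_norm cc_norm_def horizontal_lengths_eq)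
  have ne: "horizontal_lengths p q \<noteq> {}"
    by (simp only: horizontal_lengths_eq cc_norm_nonempty not_False_eq_True)
  have sub: "horizontal_lengths p q \<subseteq> ?F"
  proof
    fix l assume "l \<in> horizontal_lengths p q"
    then obtain \<gamma> where \<gamma>: "ac_curve p q \<gamma>" "horizontal \<gamma>" and l: "l = integral {0..1} (\<lambda>t. norm (hcontrol \<gamma> t))"
      by (auto simp: horizontal_lengths_def)
    obtain N where N: "negligible N" "\<And>t. t \<in> {0..1} - N \<Longrightarrow> vspeed \<gamma> t = 0"
      using horizontal_vspeed[OF \<gamma>(2)] by blast
    have "l = integral {0..1} (\<lambda>t. norm (hcontrol \<gamma> t) + \<bar>vspeed \<gamma> t\<bar>)"
      unfolding l using N(2) by (intro integral_spike[OF N(1)]) simp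
    then show "l \<in> ?F" using \<gamma>(1) by blast
  qed
  have split: "integral {0..1} (\<lambda>t. norm (hcontrol \<gamma> t)) + \<bar>integral {0..1} (vspeed \<gamma>)\<bar> \<le>
      integral {0..1} (\<lambda>t. norm (hcontrol \<gamma> t) + \<bar>vspeed \<gamma> t\<bar>)" if \<gamma>: "ac_curve p q \<gamma>" for \<gamma>
  proof -
    have "norm (integral {0..1} (vspeed \<gamma>)) \<le> integral {0..1} (\<lambda>t. \<bar>vspeed \<gamma> t\<bar>)"
      using ac_curve_decomposition(2)[OF \<gamma>]
      by (intro integral_norm_bound_integral) (auto simp: absolutely_integrable_on_def)
    then show ?thesis
      using ac_curve_decomposition(1,2)[OF \<gamma>] by (simp add: absolutely_integrable_on_def integral_add)
  qed
  have "0 \<le> l" if l: "l \<in> ?F" for l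
  proof -
    obtain \<gamma> where \<gamma>: "ac_curve p q \<gamma>" "l = integral {0..1} (\<lambda>t. norm (hcontrol \<gamma> t) + \<bar>vspeed \<gamma> t\<bar>)"
      using l by blast
    have "0 \<le> integral {0..1} (\<lambda>t. norm (hcontrol \<gamma> t))"
      using ac_curve_decomposition(1)[OF \<gamma>(1)] by (intro integral_nonneg) (auto simp: absolutely_integrable_on_def)
    with split[OF \<gamma>(1)] \<gamma>(2) show ?thesis by simp
  qed
  then have bdd: "bdd_below ?F" by (rule bdd_belowI[of _ 0])
  show "finsler_dist heis_norm p q \<le> sr_dist p q"
    unfolding F S by (rule cInf_superset_mono[OF ne bdd sub])
  assume far: "sr_dist p q \<ge> 20"
  show "sr_dist p q \<le> finsler_dist heis_norm p q"
    unfolding F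
  proof (rule cInf_greatest)
    show "?F \<noteq> {}" using ne sub by blast
    fix l assume "l \<in> ?F"
    then obtain \<gamma> where \<gamma>: "ac_curve p q \<gamma>" "l = integral {0..1} (\<lambda>t. norm (hcontrol \<gamma> t) + \<bar>vspeed \<gamma> t\<bar>)"
      by blast
    have "sr_dist p q \<le> integral {0..1} (\<lambda>t. norm (hcontrol \<gamma> t)) + \<bar>integral {0..1} (vspeed \<gamma>)\<bar>"
      using cc_norm_le_length_plus_height[OF ac_curve_decomposition(1,3)[OF \<gamma>(1)]] far
      by (simp add: sr_dist_eq_cc_norm)
    then show "sr_dist p q \<le> l" using split[OF \<gamma>(1)] \<gamma>(2) by simp
  qed
qed

corollary sr_dist_eq_finsler_dist:
  "sr_dist p q \<ge> 20 \<Longrightarrow> sr_dist p q = finsler_dist heis_norm p q"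
  using finsler_dist_le_sr_dist sr_dist_le_finsler_dist by (meson antisym)

lemma finsler_ball_eq:
  assumes "r \<ge> 20"
  shows "finsler_ball heis_norm r = {q. cc_norm q < r}"
proof -
  have "finsler_dist heis_norm 0 q < r \<longleftrightarrow> sr_dist 0 q < r" for q
    using finsler_dist_le_sr_dist[of 0 q] sr_dist_eq_finsler_dist[of 0 q] assms by linarith
  then show ?thesis by (simp add: finsler_ball_def sr_dist_eq_cc_norm hmult_unit)
qed

section \<open>Haar measure\<close>

lemma continuous_on_hmult [continuous_intros]:
  fixes f g :: "'a::topological_space \<Rightarrow> heis"
  assumes "continuous_on S f" "continuous_on S g"
  shows "continuous_on S (\<lambda>x. f x \<star> g x)"
  unfolding hmult_def hbracket_def using assms by (intro continuous_intros)

lemma hmult_measurable [measurable]: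
  assumes "f \<in> borel_measurable M" "g \<in> borel_measurable M"
  shows "(\<lambda>x. f x \<star> g x) \<in> borel_measurable M"
proof -
  have "continuous_on UNIV (\<lambda>z :: heis \<times> heis. fst z \<star> snd z)" by (intro continuous_intros)
  then show ?thesis using borel_measurable_continuous_Pair[OF assms, of "\<lambda>x y. x \<star> y"] by simp
qed

lemma lborel_linear_vimage:
  fixes f :: "real^'n::{finite,wellorder} \<Rightarrow> real^'n::_"
  assumes f: "linear f" and det: "det (matrix f) \<noteq> 0" and A: "A \<in> sets borel"
  shows "emeasure lborel A = ennreal \<bar>det (matrix f)\<bar> * emeasure lborel (f -` A)"
proof -
  let ?d = "\<bar>det (matrix f)\<bar>"
  have fm [measurable]: "f \<in> borel_measurable borel"
    using f by (simp add: borel_measurable_continuous_onI linear_continuous_on linear_conv_bounded_linear)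
  have inv: "invertible (matrix f)" using det by (simp add: invertible_det_nz)
  then have bij: "bij f"
    using f by (metis bij_def invertible_eq_bij matrix_vector_mul)
  define g where "g = inv f"
  have g: "linear g" unfolding g_def by (rule inj_linear_imp_inv_linear[OF f bij_is_inj[OF bij]])
  have vim: "f -` S = g ` S" for S
    unfolding g_def using bij by (simp add: bij_vimage_eq_inv_image)
  have "lborel = density (distr lborel borel f) (\<lambda>_. ennreal ?d)"
  proof (rule lborel_eqI)
    fix l u :: "real^'n::_" assume le: "\<And>b. b \<in> Basis \<Longrightarrow> l \<bullet> b \<le> u \<bullet> b"
    have S: "f -` box l u \<in> lmeasurable"
      unfolding vim using measurable_linear_image[OF g, of "box l u"] by simp
    have "f ` (f -` box l u) = box l u" using bij by (simp add: bij_is_surj surj_image_vimage_eq)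
    with measure_linear_image[OF f S]
    have "?d * measure lebesgue (f -` box l u) = measure lebesgue (box l u)" by simp
    moreover have "f -` box l u \<in> sets borel" using measurable_sets_borel[OF fm] by simp
    moreover have "emeasure lborel X = ennreal (measure lebesgue X)" if "X \<in> lmeasurable" "X \<in> sets borel"
      for X :: "(real^'n::_) set"
    proof -
      have "emeasure lborel X = emeasure lebesgue X" using that(2) by simp
      then show ?thesis using emeasure_eq_measure2[OF that(1)] by simp
    qed
    ultimately have "ennreal ?d * emeasure lborel (f -` box l u) = emeasure lborel (box l u)"
      using S by (simp add: ennreal_mult'[symmetric])
    then show "emeasure (density (distr lborel borel f) (\<lambda>_. ennreal ?d)) (box l u) = (\<Prod>b\<in>Basis. (u - l) \<bullet> b)"
      using le by (simp add: emeasure_density nn_integral_cmult emeasure_distr)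
  qed simp
  then have "emeasure lborel A = emeasure (density (distr lborel borel f) (\<lambda>_. ennreal ?d)) A" by simp
  also have "\<dots> = ennreal ?d * emeasure lborel (f -` A)"
    using A by (simp add: emeasure_density nn_integral_cmult emeasure_distr)
  finally show ?thesis .
qed

lemma lborel_affine_vimage:
  fixes f :: "real^'n::{finite,wellorder} \<Rightarrow> real^'n::_"
  assumes f: "linear f" and det: "\<bar>det (matrix f)\<bar> = 1" and A: "A \<in> sets borel"
  shows "emeasure lborel ((\<lambda>x. c + f x) -` A) = emeasure lborel A"
proof -
  have B: "(+) c -` A \<in> sets borel"
    using A measurable_sets_borel[of "(+) c" borel A] by simp
  have "emeasure lborel ((\<lambda>x. c + f x) -` A) = emeasure lborel (f -` ((+) c -` A))"
    by (simp add: vimage_def)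
  also have "\<dots> = emeasure lborel ((+) c -` A)"
    using lborel_linear_vimage[OF f _ B] det by auto
  also have "\<dots> = emeasure (distr lborel borel ((+) c)) A"
    using A by (simp add: emeasure_distr)
  finally show ?thesis by (simp add: lborel_distr_plus)
qed

text \<open>Right translations, and right translations composed with inversion, are affine with linear part of determinant
  \<open>1\<close> and \<open>- 1\<close>.\<close>
lemma lborel_hmult_right_vimage:
  assumes A: "A \<in> sets borel"
  shows "emeasure lborel ((\<lambda>y. y \<star> x) -` A) = emeasure lborel A"
    and "emeasure lborel ((\<lambda>y. - y \<star> x) -` A) = emeasure lborel A"
proof -
  define f where "f y = y + (1/2) *\<^sub>R hbracket y x" for y
  have lin: "linear f"
    by (rule linearI) (simp_all add: f_def heis_eq_iff hbracket_def hZ_def axis_def algebra_simps add_divide_distrib)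
  have det: "det (matrix f) = 1"
    by (simp add: det_3 matrix_def f_def hbracket_def hZ_def axis_def)
  have lin': "linear (\<lambda>y. - f y)" using lin by (rule linear_compose_neg)
  have det': "det (matrix (\<lambda>y. - f y)) = - 1"
    by (simp add: det_3 matrix_def f_def hbracket_def hZ_def axis_def)
  have eq: "(\<lambda>y. y \<star> x) = (\<lambda>y. x + f y)" "(\<lambda>y. - y \<star> x) = (\<lambda>y. x + - f y)"
    by (simp_all add: fun_eq_iff heis_eq_iff f_def hbracket_def hZ_def axis_def field_simps)
  show "emeasure lborel ((\<lambda>y. y \<star> x) -` A) = emeasure lborel A"
    unfolding eq by (rule lborel_affine_vimage[OF lin _ A]) (simp add: det)
  show "emeasure lborel ((\<lambda>y. - y \<star> x) -` A) = emeasure lborel A"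
    unfolding eq by (rule lborel_affine_vimage[OF lin' _ A]) (simp add: det')
qed

lemma haar_measureD:
  assumes "haar_measure \<mu>"
  shows "sets \<mu> = sets borel" "emeasure \<mu> UNIV \<noteq> 0"
    "A \<in> sets borel \<Longrightarrow> emeasure \<mu> ((\<lambda>x. p \<star> x) ` A) = emeasure \<mu> A"
    "compact K \<Longrightarrow> emeasure \<mu> K < \<infinity>"
  using assms unfolding haar_measure_def by blast+

lemma haar_measure_left_invariant_nn_integral:
  assumes \<mu>: "haar_measure \<mu>" and F: "F \<in> borel_measurable borel"
  shows "(\<integral>\<^sup>+x. F (y \<star> x) \<partial>\<mu>) = (\<integral>\<^sup>+x. F x \<partial>\<mu>)"
proof -
  have sets [measurable_cong]: "sets \<mu> = sets borel" by (rule haar_measureD(1)[OF \<mu>])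
  have "distr \<mu> \<mu> (\<lambda>x. y \<star> x) = \<mu>"
  proof (rule measure_eqI)
    fix A assume "A \<in> sets (distr \<mu> \<mu> (\<lambda>x. y \<star> x))"
    then have A: "A \<in> sets borel" using sets by simp
    have "(\<lambda>x. y \<star> x) -` A = (\<lambda>x. - y \<star> x) ` A"
    proof (intro equalityI subsetI)
      fix z assume "z \<in> (\<lambda>x. y \<star> x) -` A"
      then show "z \<in> (\<lambda>x. - y \<star> x) ` A"
        by (intro image_eqI[of _ _ "y \<star> z"]) (simp_all add: hmult_assoc[symmetric] hmult_inverse hmult_unit)
    qed (auto simp: hmult_assoc[symmetric] hmult_inverse hmult_unit)
    then show "emeasure (distr \<mu> \<mu> (\<lambda>x. y \<star> x)) A = emeasure \<mu> A"
      using haar_measureD(3)[OF \<mu> A, of "- y"] A by (simp add: emeasure_distr sets_eq_imp_space_eq[OF sets])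
  qed simp
  moreover have "(\<integral>\<^sup>+x. F x \<partial>distr \<mu> \<mu> (\<lambda>x. y \<star> x)) = (\<integral>\<^sup>+x. F (y \<star> x) \<partial>\<mu>)"
    using F by (intro nn_integral_distr) auto
  ultimately show ?thesis by simp
qed

lemma haar_measure_sigma_finite:
  assumes "haar_measure \<mu>"
  shows "sigma_finite_measure \<mu>"
proof
  have sets: "sets \<mu> = sets borel" by (rule haar_measureD(1)[OF assms])
  show "\<exists>A. countable A \<and> A \<subseteq> sets \<mu> \<and> \<Union>A = space \<mu> \<and> (\<forall>a\<in>A. emeasure \<mu> a \<noteq> \<infinity>)"
  proof (intro exI[of _ "range (\<lambda>n::nat. cball 0 (real n))"] conjI)
    show "range (\<lambda>n::nat. cball 0 (real n)) \<subseteq> sets \<mu>"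
      unfolding sets using borel_closed[OF closed_cball] by blast
    show "\<Union> (range (\<lambda>n::nat. cball 0 (real n))) = space \<mu>"
    proof -
      have "x \<in> \<Union> (range (\<lambda>n::nat. cball 0 (real n)))" for x :: heis
        using real_arch_simple[of "norm x"] by auto
      then show ?thesis unfolding sets_eq_imp_space_eq[OF sets] space_borel by blast
    qed
    show "\<forall>a\<in>range (\<lambda>n::nat. cball 0 (real n)). emeasure \<mu> a \<noteq> \<infinity>"
      using haar_measureD(4)[OF assms compact_cball] by (auto simp: less_top[symmetric])
  qed simp
qed

text \<open>Uniqueness of Haar measure, using that Lebesgue measure is invariant under right translations and inversion: both
  sides are the integral of the indicator of \<open>x \<in> A \<and> y \<star> x \<in> B\<close>, where the order of integration is exchanged
  and \<open>x\<close> is replaced by \<open>- y \<star> x\<close>, which \<open>\<mu>\<close> does not notice.\<close>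
theorem haar_measure_proportional_lborel:
  assumes \<mu>: "haar_measure \<mu>" and A [measurable]: "A \<in> sets borel" and B [measurable]: "B \<in> sets borel"
  shows "emeasure \<mu> A * emeasure lborel B = emeasure \<mu> B * emeasure lborel A"
proof -
  have sets [measurable_cong]: "sets \<mu> = sets borel" by (rule haar_measureD(1)[OF \<mu>])
  interpret \<mu>: sigma_finite_measure \<mu> by (rule haar_measure_sigma_finite[OF \<mu>])
  interpret pair_sigma_finite \<mu> "lborel :: heis measure" ..
  have vim: "(\<lambda>y. y \<star> x) -` B \<in> sets borel" "(\<lambda>y. - y \<star> x) -` A \<in> sets borel" for x
  proof -
    have "(\<lambda>y. y \<star> x) \<in> borel_measurable borel" "(\<lambda>y. - y \<star> x) \<in> borel_measurable borel"
      by measurable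
    from measurable_sets_borel[OF this(1) B] measurable_sets_borel[OF this(2) A]
    show "(\<lambda>y. y \<star> x) -` B \<in> sets borel" "(\<lambda>y. - y \<star> x) -` A \<in> sets borel"
      by -
  qed
  have "emeasure \<mu> A * emeasure lborel B = (\<integral>\<^sup>+x. indicator A x * emeasure lborel ((\<lambda>y. y \<star> x) -` B) \<partial>\<mu>)"
    by (simp add: lborel_hmult_right_vimage(1) nn_integral_multc)
  also have "\<dots> = (\<integral>\<^sup>+x. \<integral>\<^sup>+y. indicator A x * indicator B (y \<star> x) \<partial>lborel \<partial>\<mu>)"
  proof (intro nn_integral_cong)
    fix x
    have "(\<integral>\<^sup>+y. indicator A x * indicator B (y \<star> x) \<partial>lborel) =
        indicator A x * (\<integral>\<^sup>+y. indicator ((\<lambda>y. y \<star> x) -` B) y \<partial>lborel)"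
      by (subst nn_integral_cmult[symmetric]) (use vim in \<open>auto simp: indicator_vimage[symmetric] indicator_def\<close>)
    then show "indicator A x * emeasure lborel ((\<lambda>y. y \<star> x) -` B) =
        (\<integral>\<^sup>+y. indicator A x * indicator B (y \<star> x) \<partial>lborel)"
      using vim by simp
  qed
  also have "\<dots> = (\<integral>\<^sup>+y. \<integral>\<^sup>+x. indicator A x * indicator B (y \<star> x) \<partial>\<mu> \<partial>lborel)"
    by (rule Fubini'[symmetric]) simp
  also have "\<dots> = (\<integral>\<^sup>+y. \<integral>\<^sup>+x. indicator A (- y \<star> x) * indicator B x \<partial>\<mu> \<partial>lborel)"
  proof (rule nn_integral_cong)
    fix y :: heis
    have "(\<integral>\<^sup>+x. indicator A x * indicator B (y \<star> x) \<partial>\<mu>) =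
        (\<integral>\<^sup>+x. indicator A (- y \<star> x) * indicator B (y \<star> (- y \<star> x)) \<partial>\<mu>)"
      by (rule haar_measure_left_invariant_nn_integral[OF \<mu>, symmetric]) measurable
    then show "(\<integral>\<^sup>+x. indicator A x * indicator B (y \<star> x) \<partial>\<mu>) =
        (\<integral>\<^sup>+x. indicator A (- y \<star> x) * indicator B x \<partial>\<mu>)"
      by (simp add: hmult_assoc[symmetric] hmult_inverse hmult_unit)
  qed
  also have "\<dots> = (\<integral>\<^sup>+x. \<integral>\<^sup>+y. indicator A (- y \<star> x) * indicator B x \<partial>lborel \<partial>\<mu>)"
    by (rule Fubini') simp
  also have "\<dots> = (\<integral>\<^sup>+x. indicator B x * emeasure lborel ((\<lambda>y. - y \<star> x) -` A) \<partial>\<mu>)"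
  proof (intro nn_integral_cong)
    fix x
    have "(\<integral>\<^sup>+y. indicator A (- y \<star> x) * indicator B x \<partial>lborel) =
        indicator B x * (\<integral>\<^sup>+y. indicator ((\<lambda>y. - y \<star> x) -` A) y \<partial>lborel)"
      by (subst nn_integral_cmult[symmetric]) (use vim in \<open>auto simp: indicator_def intro!: nn_integral_cong\<close>)
    then show "(\<integral>\<^sup>+y. indicator A (- y \<star> x) * indicator B x \<partial>lborel) =
        indicator B x * emeasure lborel ((\<lambda>y. - y \<star> x) -` A)"
      using vim by simp
  qed
  also have "\<dots> = emeasure \<mu> B * emeasure lborel A"
    by (simp add: lborel_hmult_right_vimage(2) nn_integral_multc)
  finally show ?thesis .
qed

section \<open>Volume of balls\<close>

lemma lborel_dilation_vimage:
  assumes "r > 0" "A \<in> sets borel"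
  shows "emeasure lborel A = ennreal (r ^ 4) * emeasure lborel (dilation r -` A)"
proof -
  have lin: "linear (dilation r)"
    by (rule linearI) (simp_all add: heis_eq_iff algebra_simps)
  have "det (matrix (dilation r)) = r ^ 4"
    by (simp add: det_3 matrix_def axis_def power2_eq_square power4_eq_xxxx)
  then show ?thesis using lborel_linear_vimage[OF lin _ assms(2)] assms(1) by simp
qed

text \<open>By the triangle inequality, moving by \<open>- g \<star> h\<close> changes \<open>cc_norm\<close> by at most the explicit bound of
  \<open>reaches_exists\<close>, which is continuous and vanishes at the identity.\<close>
lemma open_cc_ball: "open {g. cc_norm g < r}"
proof (subst open_subopen, intro ballI)
  fix g assume "g \<in> {g. cc_norm g < r}"
  define b where "b h = norm (Complex (h $ 1) (h $ 2)) + 4 * sqrt \<bar>h $ 3\<bar>" for h :: heis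
  let ?U = "{h. cc_norm g + b (- g \<star> h) < r}"
  have "continuous_on UNIV (\<lambda>h. cc_norm g + b (- g \<star> h))"
    unfolding b_def cmod_def by (auto intro!: continuous_intros)
  then have "open ?U" by (intro open_Collect_less) auto
  moreover have "g \<in> ?U" using \<open>g \<in> _\<close> by (simp add: hmult_inverse b_def cmod_def)
  moreover have "?U \<subseteq> {g. cc_norm g < r}"
  proof
    fix h assume "h \<in> ?U"
    have "cc_norm (g \<star> (- g \<star> h)) \<le> cc_norm g + cc_norm (- g \<star> h)" by (rule cc_norm_mult)
    also have "cc_norm (- g \<star> h) \<le> b (- g \<star> h)" unfolding b_def by (rule cc_norm_le[OF reaches_exists])
    also have "g \<star> (- g \<star> h) = h" by (simp add: hmult_assoc[symmetric] hmult_inverse hmult_unit)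
    finally show "h \<in> {g. cc_norm g < r}" using \<open>h \<in> ?U\<close> by simp
  qed
  ultimately show "\<exists>T. open T \<and> g \<in> T \<and> T \<subseteq> {g. cc_norm g < r}" by blast
qed

lemma reaches_bounds:
  assumes "reaches l g"
  shows "norm (Complex (g $ 1) (g $ 2)) \<le> l" "\<bar>g $ 3\<bar> \<le> l\<^sup>2 / 2"
proof -
  obtain u where u: "u absolutely_integrable_on {0..1}" "hlift 0 u 1 = g" "integral {0..1} (\<lambda>t. norm (u t)) = l"
    using assms by (auto simp: reaches_def)
  have X: "norm (integral {0..s} u) \<le> l" if s: "s \<in> {0..1}" for s
  proof -
    have nu: "(\<lambda>t. norm (u t)) integrable_on {0..1}" "(\<lambda>t. norm (u t)) integrable_on {0..s}"
      using u(1) s by (auto simp: absolutely_integrable_on_def intro: integrable_on_subinterval)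
    have "u integrable_on {0..s}"
      using set_lebesgue_integral_eq_integral(1)[OF u(1)] s by (auto intro: integrable_on_subinterval)
    then have "norm (integral {0..s} u) \<le> integral {0..s} (\<lambda>t. norm (u t))"
      using nu by (intro integral_norm_bound_integral) auto
    also have "\<dots> \<le> l"
      unfolding u(3)[symmetric] using nu s by (intro integral_subset_le) auto
    finally show ?thesis .
  qed
  show "norm (Complex (g $ 1) (g $ 2)) \<le> l"
    using X[of 1] unfolding u(2)[symmetric] by simp
  have "\<bar>integral {0..1} (\<lambda>s. cross2 (integral {0..s} u) (u s))\<bar> \<le> l * l"
    using swept_area_le[OF u(1) X] u(3) by simp
  then show "\<bar>g $ 3\<bar> \<le> l\<^sup>2 / 2"
    unfolding u(2)[symmetric] by (simp add: power2_eq_square)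
qed

lemma bounded_cc_ball: "bounded {g. cc_norm g < 1}"
  unfolding bounded_iff
proof (intro exI[of _ 3] ballI)
  fix g assume "g \<in> {g. cc_norm g < 1}"
  then obtain l where l: "l < 1" "reaches l g" by (auto simp: cc_norm_less_iff)
  then have "0 \<le> l" using reaches_nonneg by blast
  have "\<bar>g $ 1\<bar> \<le> 1" "\<bar>g $ 2\<bar> \<le> 1"
    using reaches_bounds(1)[OF l(2)] l(1) abs_Re_le_cmod[of "Complex (g $ 1) (g $ 2)"]
      abs_Im_le_cmod[of "Complex (g $ 1) (g $ 2)"] by auto
  moreover have "\<bar>g $ 3\<bar> \<le> 1"
    using reaches_bounds(2)[OF l(2)] l(1) \<open>0 \<le> l\<close> power_le_one[of l 2] by simp
  ultimately show "norm g \<le> 3"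
    using norm_le_l1_cart[of g] by (simp add: sum_3)
qed

lemma haar_measure_cc_ball:
  assumes \<mu>: "haar_measure \<mu>"
  obtains C where "C > 0" "\<And>r. r > 0 \<Longrightarrow> emeasure \<mu> {g. cc_norm g < r} = ennreal (C * r ^ 4)"
proof -
  let ?B = "\<lambda>r. {g. cc_norm g < r}"
  have bor: "?B r \<in> sets borel" for r using open_cc_ball by (rule borel_open)
  define Q where "Q = cbox (0 :: heis) One"
  have Q: "Q \<in> sets borel" "emeasure lborel Q = 1"
    by (simp_all add: Q_def)
  have scale: "emeasure \<mu> A = emeasure \<mu> Q * emeasure lborel A" if "A \<in> sets borel" for A
    using haar_measure_proportional_lborel[OF \<mu> that Q(1)] Q(2) by simp
  have "emeasure \<mu> Q < \<infinity>" unfolding Q_def by (rule haar_measureD(4)[OF \<mu> compact_cbox])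
  moreover have "emeasure \<mu> Q \<noteq> 0"
    using scale[of UNIV] haar_measureD(2)[OF \<mu>] by auto
  ultimately obtain k where k: "k > 0" "emeasure \<mu> Q = ennreal k"
    by (metis ennreal_cases ennreal_0 infinity_ennreal_def less_le less_irrefl order_le_less)
  have "emeasure lborel (?B 1) < \<infinity>"
    using bounded_cc_ball by (rule emeasure_bounded_finite)
  moreover have "emeasure lborel (?B 1) \<noteq> 0"
  proof
    assume 0: "emeasure lborel (?B 1) = 0"
    have "cc_norm 0 \<le> 0" using cc_norm_le[OF reaches_exists[of 0]] by (simp add: cmod_def)
    then have "0 \<in> ?B 1" by simp
    then have "?B 1 \<noteq> {}" by blast
    then have "\<not> negligible (?B 1)" using open_not_negligible[OF open_cc_ball] by blast
    then show False using 0 bor[of 1] by (simp add: negligible_iff_null_sets null_sets_def)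
  qed
  ultimately obtain b where b: "b > 0" "emeasure lborel (?B 1) = ennreal b"
    by (metis ennreal_cases ennreal_0 infinity_ennreal_def less_le less_irrefl order_le_less)
  show ?thesis
  proof
    show "k * b > 0" using k b by simp
    fix r :: real assume "r > 0"
    have "dilation r -` ?B r = ?B 1"
      using cc_norm_dilation_less[OF \<open>r > 0\<close>, of _ 1] by auto
    then have "emeasure lborel (?B r) = ennreal (r ^ 4) * ennreal b"
      using lborel_dilation_vimage[OF \<open>r > 0\<close> bor[of r]] b by simp
    then show "emeasure \<mu> (?B r) = ennreal (k * b * r ^ 4)"
      using scale[OF bor[of r]] k b \<open>r > 0\<close> by (simp add: ennreal_mult[symmetric] mult_ac)
  qed
qed

theorem proposition4p9:
  fixes vol :: "heis measure"
  assumes "haar_measure vol"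
  shows "\<exists>r0>0.
    (\<forall>p q. sr_dist p q \<ge> r0 \<longrightarrow> sr_dist p q = finsler_dist heis_norm p q) \<and>
    (\<exists>C>0. \<forall>r\<ge>r0. emeasure vol (finsler_ball heis_norm r) = ennreal (C * r ^ 4))"
proof (rule exI[of _ 20], intro conjI)
  show "\<forall>p q. sr_dist p q \<ge> 20 \<longrightarrow> sr_dist p q = finsler_dist heis_norm p q"
    using sr_dist_eq_finsler_dist by blast
  obtain C where "C > 0" "\<And>r. r > 0 \<Longrightarrow> emeasure vol {g. cc_norm g < r} = ennreal (C * r ^ 4)"
    using haar_measure_cc_ball[OF assms] by blast
  then show "\<exists>C>0. \<forall>r\<ge>20. emeasure vol (finsler_ball heis_norm r) = ennreal (C * r ^ 4)"
    by (intro exI[of _ C]) (simp add: finsler_ball_eq)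
qed simp

end
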